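(* For $|z|<1$ and $0<|x|\le 1$, $$\mathbb{E}\left(z^{|\mathcal{C}(0)|}\,x^{n(0)}\right)=\frac{1}{x}\left(W(z)+\frac{1-x}{x}\log\bigl(1-xW(z)\bigr)\right),\qquad\text{where } W(z)=1-\sqrt{1-z}.$$
   Context: For a probability law $\mathcal{W}$ on isomorphism classes of finite rooted simple graphs, let $\mathcal{C}_1^{\mathcal W}(t)$ be the process started at time $0$ from a single root vertex which, when it has $k$ vertices, waits an independent exponential time of rate $k$ and then attaches an independent $\mathcal{W}$-distributed rooted graph $(C,r)$ by adding an edge from $r$ to a uniformly random vertex of the current graph (the root is unchanged). The explosion time $t_\infty$ is the limit of the jump times. If $\mathbb{E}(t_\infty)<\infty$, let $\mathcal{C}^{\mathcal W}(t)$, $t\in\mathbb{R}$, be the stationary process obtained by concatenating independent copies of $\mathcal{C}_1^{\mathcal W}$ on consecutive time intervals (returning to the singleton at each explosion), the copy whose interval contains $0$ being size-biased by its lifetime, with $0$ placed uniformly in that interval. $\mathcal{W}_0$ is the unique law $\mathcal{W}$ such that $\mathcal{C}_1^{\mathcal W}$ explodes almost surely and $\mathcal{C}^{\mathcal W}(0)$ has law $\mathcal{W}$; it is supported on finite rooted trees, and its size distribution is $w_k=\frac{2}{k}\binom{2k-2}{k-1}4^{-k}$, with generating function $W(z)=1-\sqrt{1-z}$. Write $\mathcal{C}(t)=\mathcal{C}^{\mathcal{W}_0}(t)$ (the steady state cluster growth process), with explosion times $\dots<\theta_{-1}<\theta_0<0<\theta_1<\dots$. For $\theta_i\le t<\theta_{i+1}$,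 $n(t)$ is the number of jumps of $\mathcal{C}(\cdot)$ in the time interval $(\theta_i,t]$. $|\cdot|$ denotes the number of vertices; $\log$ and the square root are principal branches. *)

theory Defs
  imports "HOL-Probability.Probability"
begin

(* A pair (n, E) is the graph with vertices 0, ..., n - 1, edge set E and root 0;
   every finite rooted simple graph is isomorphic to such a graph. *)

type_synonym labelled_graph = "nat \<times> nat set set"

definition rooted_simple_graph :: "labelled_graph \<Rightarrow> bool" where
  "rooted_simple_graph G \<longleftrightarrow>
     0 < fst G \<and> snd G \<subseteq> {e. e \<subseteq> {..<fst G} \<and> card e = 2}"

definition rooted_iso :: "labelled_graph \<Rightarrow> labelled_graph \<Rightarrow> bool" where
  "rooted_iso G H \<longleftrightarrow> rooted_simple_graph G \<and> rooted_simple_graph H \<and>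
     (\<exists>f. bij_betw f {..<fst G} {..<fst H} \<and> f 0 = 0 \<and> (`) f ` snd G = snd H)"

lemma rooted_simple_graph_singleton: "rooted_simple_graph (1, {})"
  by (simp add: rooted_simple_graph_def)

lemma rooted_iso_refl: "rooted_simple_graph G \<Longrightarrow> rooted_iso G G"
  unfolding rooted_iso_def by (intro conjI exI[of _ id]) auto

lemma rooted_iso_sym:
  assumes "rooted_iso G H" shows "rooted_iso H G"
proof -
  obtain f where G: "rooted_simple_graph G" and H: "rooted_simple_graph H"
    and f: "bij_betw f {..<fst G} {..<fst H}" "f 0 = 0" "(`) f ` snd G = snd H"
    using assms unfolding rooted_iso_def by (elim conjE exE)
  define g where "g = inv_into {..<fst G} f"
  have inj: "inj_on f {..<fst G}" using f(1) by (rule bij_betw_imp_inj_on)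
  have "g ` f ` e = e" if "e \<in> snd G" for e
  proof -
    have "e \<subseteq> {..<fst G}" using that G unfolding rooted_simple_graph_def by blast
    then show ?thesis unfolding g_def by (rule inv_into_image_cancel[OF inj])
  qed
  then have "(`) g ` (`) f ` snd G = snd G" by (simp add: image_image)
  moreover have "g 0 = 0"
    using inv_into_f_f[OF inj, of 0] G f(2) unfolding g_def rooted_simple_graph_def by simp
  moreover have "bij_betw g {..<fst H} {..<fst G}"
    unfolding g_def using f(1) by (rule bij_betw_inv_into)
  ultimately show ?thesis unfolding rooted_iso_def using G H f(3) by auto
qed

lemma rooted_iso_trans:
  assumes "rooted_iso G H" "rooted_iso H K" shows "rooted_iso G K"
proof -
  obtain f where f: "bij_betw f {..<fst G} {..<fst H}" "f 0 = 0" "(`) f ` snd G = snd H"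
    using assms unfolding rooted_iso_def by (elim conjE exE)
  obtain g where g: "bij_betw g {..<fst H} {..<fst K}" "g 0 = 0" "(`) g ` snd H = snd K"
    using assms unfolding rooted_iso_def by (elim conjE exE)
  have "(`) (g \<circ> f) ` snd G = snd K"
    unfolding g(3)[symmetric] f(3)[symmetric] by (simp add: image_image)
  then have "bij_betw (g \<circ> f) {..<fst G} {..<fst K} \<and> (g \<circ> f) 0 = 0 \<and>
      (`) (g \<circ> f) ` snd G = snd K"
    using bij_betw_trans[OF f(1) g(1)] f(2) g(2) by simp
  then have "\<exists>h. bij_betw h {..<fst G} {..<fst K} \<and> h 0 = 0 \<and> (`) h ` snd G = snd K"
    by (rule exI[of _ "g \<circ> f"])
  then show ?thesis using assms unfolding rooted_iso_def by simp
qed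

quotient_type rooted_graph = labelled_graph / partial: rooted_iso
proof (rule part_equivpI)
  show "\<exists>G. rooted_iso G G"
    using rooted_iso_refl[OF rooted_simple_graph_singleton] by blast
  show "symp rooted_iso" by (rule sympI) (rule rooted_iso_sym)
  show "transp rooted_iso" by (rule transpI) (rule rooted_iso_trans)
qed

lift_definition num_verts :: "rooted_graph \<Rightarrow> nat" is fst
  unfolding rooted_iso_def by (auto dest: bij_betw_same_card)

(* The vertices of H, shifted by the order of G, follow those of G;
   the new edge joins the vertex v of G to the root of H. *)
definition attach :: "labelled_graph \<Rightarrow> nat \<Rightarrow> labelled_graph \<Rightarrow> labelled_graph" where
  "attach G v H =
     (fst G + fst H, snd G \<union> (`) (\<lambda>u. fst G + u) ` snd H \<union> {{v, fst G}})"

(* The marks attached to the integer k drive the growth process while it has k vertices: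
   the waiting time (exponential of rate k), the vertex to which the next graph is
   attached (uniform), and the attached graph (of law W).  The number of vertices strictly
   increases at each jump, so each mark is used at most once, and the marks used at
   different jumps are independent. *)

type_synonym marks = "nat \<Rightarrow> real \<times> nat \<times> rooted_graph"

definition growth_space :: "rooted_graph pmf \<Rightarrow> marks measure" where
  "growth_space W = (\<Pi>\<^sub>M k\<in>{1..}.
     density lborel (exponential_density (real k)) \<Otimes>\<^sub>M
       (measure_pmf (pmf_of_set {..<k}) \<Otimes>\<^sub>M measure_pmf W))"

primrec jump_chain :: "marks \<Rightarrow> nat \<Rightarrow> labelled_graph" where
  "jump_chain \<omega> 0 = (1, {})"
| "jump_chain \<omega> (Suc m) =
     (let G = jump_chain \<omega> m; (_, v, H) = \<omega> (fst G) in attach G v (rep_rooted_graph H))"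

definition waiting_time :: "marks \<Rightarrow> nat \<Rightarrow> real" where
  "waiting_time \<omega> m = fst (\<omega> (fst (jump_chain \<omega> m)))"

definition jump_time :: "marks \<Rightarrow> nat \<Rightarrow> real" where
  "jump_time \<omega> m = (\<Sum>j<m. waiting_time \<omega> j)"

(* The jump times increase almost surely, so the supremum is their limit. *)
definition explosion_time :: "marks \<Rightarrow> ennreal" where
  "explosion_time \<omega> = (SUP m. ennreal (jump_time \<omega> m))"

(* Meaningful for times 0 \<le> t < explosion_time. *)
definition growth_process :: "marks \<Rightarrow> real \<Rightarrow> rooted_graph" where
  "growth_process \<omega> t =
     abs_rooted_graph (jump_chain \<omega> (LEAST m. t < jump_time \<omega> (Suc m)))"

definition mean_explosion_time :: "rooted_graph pmf \<Rightarrow> ennreal" where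
  "mean_explosion_time W = (\<integral>\<^sup>+\<omega>. explosion_time \<omega> \<partial>growth_space W)"

definition size_biased_growth_space :: "rooted_graph pmf \<Rightarrow> marks measure" where
  "size_biased_growth_space W =
     density (growth_space W) (\<lambda>\<omega>. explosion_time \<omega> / mean_explosion_time W)"

(* Independent copies indexed by the integers, copy 0 being the one alive at time 0,
   together with the relative position in [0,1] of time 0 in the lifetime of copy 0.
   Meaningful only if mean_explosion_time W is finite. *)
definition stationary_space :: "rooted_graph pmf \<Rightarrow> ((int \<Rightarrow> marks) \<times> real) measure" where
  "stationary_space W =
     (\<Pi>\<^sub>M i\<in>UNIV. if i = 0 then size_biased_growth_space W else growth_space W)
       \<Otimes>\<^sub>M uniform_measure lborel {0..1}"

definition lifetime :: "(int \<Rightarrow> marks) \<times> real \<Rightarrow> int \<Rightarrow> real" where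
  "lifetime \<omega> i = enn2real (explosion_time (fst \<omega> i))"

(* So theta_0 = - u * lifetime_0 and theta_(i+1) - theta_i = lifetime_i for all i. *)
definition theta :: "(int \<Rightarrow> marks) \<times> real \<Rightarrow> int \<Rightarrow> real" where
  "theta \<omega> i =
     (if 0 \<le> i then \<Sum>j\<in>{0..<i}. lifetime \<omega> j else - (\<Sum>j\<in>{i..<0}. lifetime \<omega> j))
       - snd \<omega> * lifetime \<omega> 0"

definition current_copy :: "(int \<Rightarrow> marks) \<times> real \<Rightarrow> real \<Rightarrow> int" where
  "current_copy \<omega> t = (THE i. theta \<omega> i \<le> t \<and> t < theta \<omega> (i + 1))"

definition cluster_process :: "(int \<Rightarrow> marks) \<times> real \<Rightarrow> real \<Rightarrow> rooted_graph" where
  "cluster_process \<omega> t =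
     (let i = current_copy \<omega> t in growth_process (fst \<omega> i) (t - theta \<omega> i))"

definition num_jumps :: "(int \<Rightarrow> marks) \<times> real \<Rightarrow> real \<Rightarrow> nat" where
  "num_jumps \<omega> t =
     (let i = current_copy \<omega> t
      in card {m. theta \<omega> i + jump_time (fst \<omega> i) m \<in> {theta \<omega> i<..t}})"

definition steady_state_law :: "rooted_graph pmf \<Rightarrow> bool" where
  "steady_state_law W \<longleftrightarrow>
     mean_explosion_time W < \<infinity> \<and>
     (AE \<omega> in growth_space W. explosion_time \<omega> < \<infinity>) \<and>
     distr (stationary_space W) (count_space UNIV) (\<lambda>\<omega>. cluster_process \<omega> 0) = measure_pmf W"

end

theory Submission
  imports Defs
begin

text \<open>
  Write \<open>K\<^sub>m\<close> for the number of vertices after \<open>m\<close> jumps, \<open>w\<close> for the generating function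
  of the size of a graph of law \<open>W\<^sub>0\<close>, and \<open>\<mu>\<close> for the mean explosion time.

  Time \<open>0\<close> is a uniform point in the lifetime of a size-biased copy, so the pair formed by
  the cluster at time \<open>0\<close> and the number of jumps before it has the law obtained by averaging over
  the whole lifetime of an ordinary copy and dividing by \<open>\<mu>\<close>.  The copy has made exactly \<open>m\<close> jumps
  during its \<open>m\<close>-th waiting time, counted from \<open>0\<close>, whose mean given \<open>K\<^sub>m = k\<close> is \<open>1 / k\<close>.  Hence size \<open>k\<close> and jump
  count \<open>m\<close> occur together with probability \<open>P (K\<^sub>m = k) / (\<mu> k)\<close>
  (\<open>emeasure_size_and_jumps\<close>).  Since \<open>K\<^sub>m - 1\<close> is a sum of \<open>m\<close> independent sizes,
  \<open>P (K\<^sub>m = k + 1)\<close> is the coefficient of \<open>z\<^sup>k\<close> in \<open>w\<^sup>m\<close> (\<open>emeasure_chain_size\<close>).  The sought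
  generating function \<open>F\<close> therefore satisfies \<open>F(0) = 0\<close> and
  \<open>\<mu> F'(z) = (\<Sum>m. x\<^sup>m w(z)\<^sup>m) = 1 / (1 - x w(z))\<close>.

  Stationarity says that for \<open>x = 1\<close> this function is \<open>w\<close> itself, so \<open>\<mu> w' (1 - w) = 1\<close> and, after
  integration, \<open>\<mu> (2 w - w\<^sup>2) = 2 z\<close>.  As \<open>w(1) = 1\<close>, this forces \<open>\<mu> = 2\<close> and
  \<open>(1 - w)\<^sup>2 = 1 - z\<close>, that is, \<open>w(z) = 1 - \<surd>(1 - z)\<close>.  Finally, the closed form, as a
  function of \<open>z\<close>, also vanishes at \<open>0\<close> and has the same derivative \<open>1 / (2 (1 - x w))\<close> on the
  unit disc (\<open>jump_generating_function\<close>).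
\<close>

section \<open>Rooted graphs and the marks of the growth process\<close>

lemma rooted_simple_graph_rep: "rooted_simple_graph (rep_rooted_graph H)"
  using Quotient_rep_reflp[OF Quotient_rooted_graph, of H] by (simp add: rooted_iso_def)

lemma num_verts_pos: "0 < num_verts H"
  using rooted_simple_graph_rep[of H] by (simp add: num_verts.rep_eq rooted_simple_graph_def)

lemma num_verts_abs: "rooted_simple_graph G \<Longrightarrow> num_verts (abs_rooted_graph G) = fst G"
  by (rule num_verts.abs_eq) (rule rooted_iso_refl)

definition mark_law :: "rooted_graph pmf \<Rightarrow> nat \<Rightarrow> (real \<times> nat \<times> rooted_graph) measure" where
  "mark_law W k = density lborel (exponential_density (real k)) \<Otimes>\<^sub>M
     (measure_pmf (pmf_of_set {..<k}) \<Otimes>\<^sub>M measure_pmf W)"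

lemma growth_space_eq: "growth_space W = (\<Pi>\<^sub>M k\<in>{1..}. mark_law W k)"
  by (simp add: growth_space_def mark_law_def)

lemma prob_space_mark_law: "1 \<le> k \<Longrightarrow> prob_space (mark_law W k)"
  unfolding mark_law_def
  by (intro prob_space_pair prob_space_exponential_density prob_space_measure_pmf) auto

lemma prob_space_growth_space: "prob_space (growth_space W)"
  unfolding growth_space_eq by (intro prob_space_PiM prob_space_mark_law) auto

lemma sets_mark_law [measurable_cong]:
  "sets (mark_law W k) = sets (borel \<Otimes>\<^sub>M (count_space UNIV \<Otimes>\<^sub>M count_space UNIV))"
  unfolding mark_law_def by (intro sets_pair_measure_cong) auto

lemma measurable_mark:
  "1 \<le> k \<Longrightarrow> (\<lambda>\<omega>. \<omega> k) \<in> growth_space W \<rightarrow>\<^sub>M borel \<Otimes>\<^sub>M (count_space UNIV \<Otimes>\<^sub>M count_space UNIV)"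
proof -
  assume "1 \<le> k"
  then have "(\<lambda>\<omega>. \<omega> k) \<in> growth_space W \<rightarrow>\<^sub>M mark_law W k"
    unfolding growth_space_eq by (intro measurable_component_singleton) auto
  then show ?thesis by (simp only: measurable_cong_sets[OF refl sets_mark_law])
qed

section \<open>The jump chain and its measurability\<close>

lemma jump_chain_Suc:
  "jump_chain \<omega> (Suc m) =
     attach (jump_chain \<omega> m) (fst (snd (\<omega> (fst (jump_chain \<omega> m)))))
       (rep_rooted_graph (snd (snd (\<omega> (fst (jump_chain \<omega> m))))))"
  by (simp add: Let_def case_prod_beta)

lemma fst_jump_chain_Suc:
  "fst (jump_chain \<omega> (Suc m)) = fst (jump_chain \<omega> m)
     + num_verts (snd (snd (\<omega> (fst (jump_chain \<omega> m)))))"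
  by (simp only: jump_chain_Suc attach_def fst_conv num_verts.rep_eq)

declare jump_chain.simps(2) [simp del]

lemma fst_jump_chain_less: "fst (jump_chain \<omega> m) < fst (jump_chain \<omega> (Suc m))"
  using num_verts_pos by (simp add: fst_jump_chain_Suc)

lemma fst_jump_chain_pos: "1 \<le> fst (jump_chain \<omega> m)"
  by (induction m) (auto simp: fst_jump_chain_Suc)

text \<open>Sizes strictly increase along the chain, so a chain that has not grown beyond \<open>k\<close> vertices has
  read only marks with index below \<open>k\<close>.\<close>

lemma jump_chain_upd_le:
  "fst (jump_chain \<eta> m) \<le> k \<Longrightarrow> jump_chain (\<eta>(k := y)) m = jump_chain \<eta> m"
proof (induction m)
  case (Suc m)
  then have "fst (jump_chain \<eta> m) < k" using fst_jump_chain_less[of \<eta> m] by simp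
  with Suc.IH show ?case by (simp add: jump_chain_Suc)
qed simp

text \<open>The form in which the independence of the marks is used: the event that the chain has \<open>k\<close>
  vertices after \<open>m\<close> jumps does not depend on the mark of index \<open>k\<close>.\<close>

lemma fst_jump_chain_upd_iff:
  "fst (jump_chain (\<eta>(k := y)) m) = k \<longleftrightarrow> fst (jump_chain \<eta> m) = k"
proof
  assume "fst (jump_chain (\<eta>(k := y)) m) = k"
  then show "fst (jump_chain \<eta> m) = k"
    using jump_chain_upd_le[of "\<eta>(k := y)" m k "\<eta> k"] by simp
qed (simp add: jump_chain_upd_le)

text \<open>On the null set where a mark asks for a nonexistent attachment vertex, the chain may leave
  the simple graphs.  It always stays in this countable set, which is what makes it measurable as a discrete
  random variable: the type of labelled graphs itself is uncountable.\<close>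

definition finite_graphs :: "labelled_graph set" where
  "finite_graphs = {1..} \<times> {E. finite E \<and> E \<subseteq> {e. finite e}}"

lemma countable_finite_graphs: "countable finite_graphs"
  unfolding finite_graphs_def
  by (intro countable_SIGMA countable_Collect_finite_subset countable_Collect_finite) auto

lemma attach_finite_graphs: "G \<in> finite_graphs \<Longrightarrow> rooted_simple_graph H \<Longrightarrow> attach G v H \<in> finite_graphs"
proof -
  assume G: "G \<in> finite_graphs" and H: "rooted_simple_graph H"
  have sub: "snd H \<subseteq> Pow {..<fst H}" using H by (auto simp: rooted_simple_graph_def)
  then have "finite (snd H)" by (rule finite_subset) simp
  moreover have "\<forall>e\<in>snd H. finite e" using sub by (auto intro: finite_subset)
  ultimately show ?thesis using G by (auto simp: finite_graphs_def attach_def)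
qed

lemma measurable_jump_chain:
  "(\<lambda>\<omega>. jump_chain \<omega> m) \<in> growth_space W \<rightarrow>\<^sub>M count_space finite_graphs"
proof (induction m)
  case 0
  show ?case by (simp add: finite_graphs_def)
next
  case (Suc m)
  define f where "f G \<omega> = attach G (fst (snd (\<omega> (fst G)))) (rep_rooted_graph (snd (snd (\<omega> (fst G)))))"
    for G :: labelled_graph and \<omega> :: marks
  have "f G \<in> growth_space W \<rightarrow>\<^sub>M count_space finite_graphs" if G: "G \<in> finite_graphs" for G
  proof -
    have k: "1 \<le> fst G" using G by (auto simp: finite_graphs_def)
    have [measurable]: "(\<lambda>\<omega>. fst (snd (\<omega> (fst G)))) \<in> growth_space W \<rightarrow>\<^sub>M count_space UNIV"
      "(\<lambda>\<omega>. snd (snd (\<omega> (fst G)))) \<in> growth_space W \<rightarrow>\<^sub>M count_space UNIV"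
      using measurable_mark[OF k, of W] by measurable
    have "(\<lambda>\<omega>. attach G v (rep_rooted_graph (snd (snd (\<omega> (fst G))))))
        \<in> growth_space W \<rightarrow>\<^sub>M count_space finite_graphs" for v
      by (rule measurable_compose[where N = "count_space UNIV"], measurable)
        (auto intro: attach_finite_graphs G rooted_simple_graph_rep)
    then show ?thesis unfolding f_def
      by (rule measurable_compose_countable) measurable
  qed
  then have "(\<lambda>\<omega>. f (jump_chain \<omega> m) \<omega>) \<in> growth_space W \<rightarrow>\<^sub>M count_space finite_graphs"
    by (rule measurable_compose_countable'[OF _ Suc countable_finite_graphs])
  then show ?case by (simp add: f_def jump_chain_Suc)
qed

lemma measurable_jump_chain_UNIV [measurable]:
  "(\<lambda>\<omega>. jump_chain \<omega> m) \<in> growth_space W \<rightarrow>\<^sub>M count_space UNIV"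
  by (rule measurable_compose[OF measurable_jump_chain]) simp

lemma measurable_waiting_time [measurable]: "(\<lambda>\<omega>. waiting_time \<omega> m) \<in> borel_measurable (growth_space W)"
proof -
  have "(\<lambda>\<omega>. fst (\<omega> (fst G))) \<in> borel_measurable (growth_space W)" if "G \<in> finite_graphs" for G
    using that measurable_mark[of "fst G" W] by (auto simp: finite_graphs_def)
  then show ?thesis unfolding waiting_time_def
    by (rule measurable_compose_countable'[OF _ measurable_jump_chain countable_finite_graphs])
qed

lemma measurable_jump_time [measurable]: "(\<lambda>\<omega>. jump_time \<omega> m) \<in> borel_measurable (growth_space W)"
  unfolding jump_time_def by measurable

lemma measurable_explosion_time [measurable]: "explosion_time \<in> borel_measurable (growth_space W)"
  unfolding explosion_time_def[abs_def] by measurable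

lemma measurable_growth_process [measurable]:
  "(\<lambda>(\<omega>, t). growth_process \<omega> t) \<in> growth_space W \<Otimes>\<^sub>M borel \<rightarrow>\<^sub>M count_space UNIV"
proof -
  have "(\<lambda>p. abs_rooted_graph (jump_chain (fst p) m)) \<in> growth_space W \<Otimes>\<^sub>M borel \<rightarrow>\<^sub>M count_space UNIV" for m
    by (rule measurable_compose[OF measurable_compose[OF measurable_fst measurable_jump_chain_UNIV]]) simp
  then have "(\<lambda>p. abs_rooted_graph (jump_chain (fst p) (LEAST m. snd p < jump_time (fst p) (Suc m))))
     \<in> growth_space W \<Otimes>\<^sub>M borel \<rightarrow>\<^sub>M count_space UNIV"
    by (rule measurable_compose_countable) measurable
  then show ?thesis by (simp add: growth_process_def case_prod_beta)
qed

section \<open>The law of the size after a given number of jumps\<close>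

text \<open>Fubini for the splitting of the product space into the coordinate \<open>k\<close> and all others.  The
  invariance of \<open>h\<close> under updates at \<open>k\<close> expresses that \<open>h\<close> is a function of the other
  coordinates, without having to name that function.\<close>

lemma nn_integral_growth_space_indep:
  assumes k: "1 \<le> k" and g: "g \<in> borel_measurable (mark_law W k)"
    and h: "h \<in> borel_measurable (growth_space W)"
    and upd: "\<And>\<eta> y. h (\<eta>(k := y)) = h \<eta>"
  shows "(\<integral>\<^sup>+\<eta>. g (\<eta> k) * h \<eta> \<partial>growth_space W)
           = (\<integral>\<^sup>+p. g p \<partial>mark_law W k) * (\<integral>\<^sup>+\<eta>. h \<eta> \<partial>growth_space W)"
proof -
  define R where "R = (\<Pi>\<^sub>M i\<in>{1..} - {k}. mark_law W i)"
  have ins: "insert k ({1..} - {k}) = {1::nat..}" using k by auto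
  interpret K: prob_space "mark_law W k" by (rule prob_space_mark_law[OF k])
  interpret R: prob_space R unfolding R_def by (intro prob_space_PiM prob_space_mark_law) auto
  interpret P: pair_sigma_finite "mark_law W k" R by unfold_locales
  have join [measurable]: "(\<lambda>(x, X). X(k := x)) \<in> mark_law W k \<Otimes>\<^sub>M R \<rightarrow>\<^sub>M growth_space W"
    unfolding R_def growth_space_eq case_prod_beta
    by (rule measurable_fun_upd[where J = "{1..} - {k}"]) (use ins in auto)
  have D: "distr (mark_law W k \<Otimes>\<^sub>M R) (growth_space W) (\<lambda>(x, X). X(k := x)) = growth_space W"
    unfolding R_def growth_space_eq
    by (rule distr_pair_PiM_eq_PiM[of "{1..} - {k}" "mark_law W" k, unfolded ins])
      (use k in \<open>auto intro!: prob_space_mark_law\<close>)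
  have split: "(\<integral>\<^sup>+\<eta>. f (\<eta> k) * h \<eta> \<partial>growth_space W)
      = (\<integral>\<^sup>+p. f p \<partial>mark_law W k) * (\<integral>\<^sup>+X. h X \<partial>R)"
    if f [measurable]: "f \<in> borel_measurable (mark_law W k)" for f
  proof -
    \<comment> \<open>An arbitrary mark fills the free coordinate, so that \<open>h\<close> can be read as a function on \<open>R\<close>.\<close>
    define y0 :: "real \<times> nat \<times> rooted_graph" where "y0 = undefined"
    have "y0 \<in> space (mark_law W k)"
      unfolding sets_eq_imp_space_eq[OF sets_mark_law] by (simp add: space_pair_measure)
    then have "(\<lambda>X. X(k := y0)) \<in> R \<rightarrow>\<^sub>M growth_space W"
      unfolding R_def growth_space_eq
      by (intro measurable_fun_upd[where J = "{1..} - {k}"]) (use ins in auto)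
    from measurable_compose[OF this h] have hR [measurable]: "h \<in> borel_measurable R"
      by (simp add: upd)
    have "(\<lambda>\<eta>. \<eta> k) \<in> growth_space W \<rightarrow>\<^sub>M mark_law W k"
      unfolding growth_space_eq using k by (intro measurable_component_singleton) auto
    note [measurable] = measurable_compose[OF this f] h
    have "(\<integral>\<^sup>+\<eta>. f (\<eta> k) * h \<eta> \<partial>growth_space W)
        = (\<integral>\<^sup>+q. f (fst q) * h (snd q) \<partial>(mark_law W k \<Otimes>\<^sub>M R))"
      by (subst D[symmetric], subst nn_integral_distr) (auto simp: case_prod_beta upd)
    also have "\<dots> = (\<integral>\<^sup>+p. \<integral>\<^sup>+X. f p * h X \<partial>R \<partial>mark_law W k)"
      by (subst R.nn_integral_fst[symmetric]) auto
    also have "\<dots> = (\<integral>\<^sup>+p. f p \<partial>mark_law W k) * (\<integral>\<^sup>+X. h X \<partial>R)"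
      by (simp add: nn_integral_cmult nn_integral_multc)
    finally show ?thesis .
  qed
  from split[of "\<lambda>_. 1"] have "(\<integral>\<^sup>+\<eta>. h \<eta> \<partial>growth_space W) = (\<integral>\<^sup>+X. h X \<partial>R)"
    by (simp add: K.emeasure_space_1)
  with split[OF g] show ?thesis by simp
qed

lemma nn_integral_mark_law_time:
  assumes k: "1 \<le> k"
  shows "(\<integral>\<^sup>+p. ennreal (fst p) \<partial>mark_law W k) = ennreal (1 / real k)"
proof -
  interpret N: prob_space "measure_pmf (pmf_of_set {..<k}) \<Otimes>\<^sub>M measure_pmf W"
    by (intro prob_space_pair prob_space_measure_pmf)
  have "(\<integral>\<^sup>+p. ennreal (fst p) \<partial>mark_law W k)
      = (\<integral>\<^sup>+t. ennreal t \<partial>density lborel (exponential_density (real k)))"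
    unfolding mark_law_def
    by (subst N.nn_integral_fst[symmetric]) (auto simp: N.emeasure_space_1)
  also have "\<dots> = (\<integral>\<^sup>+t. ennreal (exponential_density (real k) t * t ^ 1) \<partial>lborel)"
    by (subst nn_integral_density)
      (auto intro!: nn_integral_cong simp: ennreal_mult' exponential_density_nonneg)
  also have "\<dots> = ennreal (1 / real k)"
    using nn_integral_erlang_ith_moment[of "real k" 0 1] k by simp
  finally show ?thesis .
qed

lemma emeasure_mark_law_num_verts:
  assumes k: "1 \<le> k"
  shows "emeasure (mark_law W k) {p. num_verts (snd (snd p)) = i} = ennreal (pmf (map_pmf num_verts W) i)"
proof -
  interpret T: prob_space "density lborel (exponential_density (real k))"
    using k by (intro prob_space_exponential_density) auto
  interpret V: prob_space "measure_pmf (pmf_of_set {..<k})" by (rule prob_space_measure_pmf)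
  interpret H: prob_space "measure_pmf W" by (rule prob_space_measure_pmf)
  interpret N: prob_space "measure_pmf (pmf_of_set {..<k}) \<Otimes>\<^sub>M measure_pmf W"
    by (intro prob_space_pair prob_space_measure_pmf)
  have "{p :: real \<times> nat \<times> rooted_graph. num_verts (snd (snd p)) = i} = UNIV \<times> (UNIV \<times> {H. num_verts H = i})"
    by auto
  then have "emeasure (mark_law W k) {p. num_verts (snd (snd p)) = i}
      = emeasure (density lborel (exponential_density (real k))) UNIV *
        (emeasure (measure_pmf (pmf_of_set {..<k})) UNIV * emeasure W {H. num_verts H = i})"
    unfolding mark_law_def
    by (simp only:) (subst N.emeasure_pair_measure_Times, simp, simp add: pair_measureI,
        subst measure_pmf.emeasure_pair_measure_Times, simp_all)
  also have "\<dots> = emeasure W {H. num_verts H = i}"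
    using T.emeasure_space_1 by (simp add: space_density)
  also have "\<dots> = ennreal (pmf (map_pmf num_verts W) i)"
    by (simp add: pmf_map measure_pmf.emeasure_eq_measure vimage_def)
  finally show ?thesis .
qed

lemma sets_num_verts: "{p. num_verts (snd (snd p)) = i} \<in> sets (mark_law W k)"
proof -
  have [measurable]: "(\<lambda>p :: real \<times> nat \<times> rooted_graph. num_verts (snd (snd p)))
      \<in> borel \<Otimes>\<^sub>M (count_space UNIV \<Otimes>\<^sub>M count_space UNIV) \<rightarrow>\<^sub>M count_space UNIV"
    by (rule measurable_compose[where g = num_verts and N = "count_space UNIV"]) auto
  have "Measurable.pred (mark_law W k) (\<lambda>p. num_verts (snd (snd p)) = i)"
    by measurable
  then show ?thesis
    unfolding pred_def sets_eq_imp_space_eq[OF sets_mark_law] by (simp add: space_pair_measure)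
qed

text \<open>The almost sure properties of the marks on which the pathwise arguments rely: positive waiting
  times, so that jump times strictly increase, and existing attachment vertices, so that the
  chain consists of simple graphs.\<close>

definition good_marks :: "marks \<Rightarrow> bool" where
  "good_marks \<eta> \<longleftrightarrow> (\<forall>k\<ge>1. 0 < fst (\<eta> k) \<and> fst (snd (\<eta> k)) < k)"

lemma AE_mark_law:
  assumes k: "1 \<le> k"
  shows "AE p in mark_law W k. 0 < fst p \<and> fst (snd p) < k"
proof -
  interpret T: prob_space "density lborel (exponential_density (real k))"
    using k by (intro prob_space_exponential_density) auto
  interpret V: prob_space "measure_pmf (pmf_of_set {..<k})" by (rule prob_space_measure_pmf)
  interpret H: prob_space "measure_pmf W" by (rule prob_space_measure_pmf)
  interpret VH: pair_sigma_finite "measure_pmf (pmf_of_set {..<k})" "measure_pmf W" ..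
  interpret N: prob_space "measure_pmf (pmf_of_set {..<k}) \<Otimes>\<^sub>M measure_pmf W"
    by (intro prob_space_pair prob_space_measure_pmf)
  interpret TN: pair_sigma_finite "density lborel (exponential_density (real k))"
    "measure_pmf (pmf_of_set {..<k}) \<Otimes>\<^sub>M measure_pmf W" ..
  have 1: "AE q in measure_pmf (pmf_of_set {..<k}) \<Otimes>\<^sub>M measure_pmf W. fst q < k"
  proof (rule VH.AE_pair_measure)
    have "set_pmf (pmf_of_set {..<k}) = {..<k}" using k by (intro set_pmf_of_set) (auto simp: lessThan_empty_iff bot_nat_def)
    then show "AE v in measure_pmf (pmf_of_set {..<k}). AE H in measure_pmf W. fst (v, H) < k"
      by (auto simp: AE_measure_pmf_iff)
  qed measurable
  have 2: "AE t in density lborel (exponential_density (real k)). 0 < t"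
    using AE_lborel_singleton[of "0::real"]
    by (subst AE_density) (auto simp: exponential_density_def split: if_splits elim!: eventually_mono)
  show ?thesis unfolding mark_law_def
  proof (rule TN.AE_pair_measure)
    show "AE t in density lborel (exponential_density (real k)).
        AE q in measure_pmf (pmf_of_set {..<k}) \<Otimes>\<^sub>M measure_pmf W. 0 < fst (t, q) \<and> fst (snd (t, q)) < k"
      using 2 1 by (auto elim!: eventually_mono)
  qed measurable
qed

lemma AE_good_marks: "AE \<eta> in growth_space W. good_marks \<eta>"
  unfolding good_marks_def growth_space_eq AE_all_countable
proof
  fix k :: nat
  show "AE \<eta> in Pi\<^sub>M {1..} (mark_law W). 1 \<le> k \<longrightarrow> 0 < fst (\<eta> k) \<and> fst (snd (\<eta> k)) < k"
  proof (cases "1 \<le> k")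
    case True
    have "AE \<eta> in Pi\<^sub>M {1..} (mark_law W). 0 < fst (\<eta> k) \<and> fst (snd (\<eta> k)) < k"
      by (rule AE_PiM_component[where P = "\<lambda>p. 0 < fst p \<and> fst (snd p) < k"])
        (use True AE_mark_law[OF True] in \<open>simp_all add: prob_space_mark_law\<close>)
    then show ?thesis by simp
  qed simp
qed

lemma rooted_simple_graph_attach:
  assumes G: "rooted_simple_graph G" and H: "rooted_simple_graph H" and v: "v < fst G"
  shows "rooted_simple_graph (attach G v H)"
proof -
  have "(\<lambda>u. fst G + u) ` e \<subseteq> {..<fst G + fst H} \<and> card ((\<lambda>u. fst G + u) ` e) = 2" if "e \<in> snd H" for e
  proof -
    have "e \<subseteq> {..<fst H}" "card e = 2" using that H by (auto simp: rooted_simple_graph_def)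
    then show ?thesis by (auto simp: card_image)
  qed
  moreover have "e \<subseteq> {..<fst G + fst H} \<and> card e = 2" if "e \<in> snd G" for e
    using that G by (force simp: rooted_simple_graph_def)
  ultimately show ?thesis
    using G H v by (auto simp: rooted_simple_graph_def attach_def)
qed

lemma rooted_simple_graph_jump_chain:
  "good_marks \<eta> \<Longrightarrow> rooted_simple_graph (jump_chain \<eta> m)"
proof (induction m)
  case 0
  show ?case by (simp add: rooted_simple_graph_singleton[simplified])
next
  case (Suc m)
  then show ?case using fst_jump_chain_pos[of \<eta> m]
    by (simp only: jump_chain_Suc)
      (intro rooted_simple_graph_attach rooted_simple_graph_rep, auto simp: good_marks_def)
qed

definition size_fps :: "rooted_graph pmf \<Rightarrow> real fps" where
  "size_fps W = Abs_fps (pmf (map_pmf num_verts W))"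

text \<open>The chain has \<open>k + 1\<close> vertices after the next jump iff, for some \<open>j \<le> k\<close>, it has \<open>j + 1\<close> vertices
  now and the graph in the mark \<open>j + 1\<close> has \<open>k - j\<close> vertices.  These two events are independent, so
  one more jump multiplies the generating function by that of the size.  The index shift accounts
  for the initial vertex.\<close>

lemma emeasure_chain_size:
  "emeasure (growth_space W) {\<eta> \<in> space (growth_space W). fst (jump_chain \<eta> m) = Suc k}
     = ennreal (fps_nth (size_fps W ^ m) k)"
  and size_fps_power_nonneg: "0 \<le> fps_nth (size_fps W ^ m) k"
proof (induction m arbitrary: k)
  case 0
  {
    case 1
    interpret prob_space "growth_space W" by (rule prob_space_growth_space)
    show ?case using emeasure_space_1 by (cases k) auto
  next
    case 2
    show ?case by (cases k) auto
  }
next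
  case (Suc m)
  {
    case 1
    let ?G = "growth_space W" and ?w = "pmf (map_pmf num_verts W)"
    let ?K = "\<lambda>\<eta>. fst (jump_chain \<eta> m)"
    have [measurable]: "{\<eta> \<in> space ?G. ?K \<eta> = i} \<in> sets ?G" for m i
      by measurable
    have mark: "(\<lambda>\<eta>. \<eta> (Suc j)) \<in> growth_space W \<rightarrow>\<^sub>M mark_law W (Suc j)" for j
      unfolding growth_space_eq by (rule measurable_component_singleton) simp
    have [measurable]: "(\<lambda>\<eta>. indicator {p. num_verts (snd (snd p)) = i} (\<eta> (Suc j)) :: ennreal)
        \<in> borel_measurable (growth_space W)" for i j
      by (rule measurable_compose[OF mark borel_measurable_indicator[OF sets_num_verts]])
    have [measurable]: "(\<lambda>\<eta>. indicator {\<eta>. ?K \<eta> = Suc j} \<eta> :: ennreal) \<in> borel_measurable ?G" for j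
      by measurable
    have "emeasure ?G {\<eta> \<in> space ?G. fst (jump_chain \<eta> (Suc m)) = Suc k}
        = (\<integral>\<^sup>+\<eta>. indicator {\<eta> \<in> space ?G. fst (jump_chain \<eta> (Suc m)) = Suc k} \<eta> \<partial>?G)"
      by (subst nn_integral_indicator) measurable
    also have "\<dots> = (\<integral>\<^sup>+\<eta>. (\<Sum>j\<le>k. indicator {p. num_verts (snd (snd p)) = k - j} (\<eta> (Suc j)) *
          (indicator {\<eta>. ?K \<eta> = Suc j} \<eta>)) \<partial>?G)"
    proof (rule nn_integral_cong)
      fix \<eta> assume \<eta>: "\<eta> \<in> space ?G"
      obtain i where i: "?K \<eta> = Suc i" using fst_jump_chain_pos[of \<eta> m] by (cases "?K \<eta>") auto
      have *: "fst (jump_chain \<eta> (Suc m)) = Suc k \<longleftrightarrow> i \<le> k \<and> num_verts (snd (snd (\<eta> (Suc i)))) = k - i"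
        by (auto simp: fst_jump_chain_Suc i)
      then show "indicator {\<eta> \<in> space ?G. fst (jump_chain \<eta> (Suc m)) = Suc k} \<eta> =
          (\<Sum>j\<le>k. indicator {p. num_verts (snd (snd p)) = k - j} (\<eta> (Suc j)) *
            (indicator {\<eta>. ?K \<eta> = Suc j} \<eta> :: ennreal))"
        (is "_ = ?S")
      proof -
        have "?S = (\<Sum>j\<le>k. if j = i then indicator {p. num_verts (snd (snd p)) = k - i} (\<eta> (Suc i)) else 0)"
          by (rule sum.cong) (auto simp: i indicator_def)
        also have "\<dots> = (if i \<le> k then indicator {p. num_verts (snd (snd p)) = k - i} (\<eta> (Suc i)) else 0)"
          by simp
        finally show ?thesis using \<eta> * by (simp add: indicator_def)
      qed
    qed
    also have "\<dots> = (\<Sum>j\<le>k. \<integral>\<^sup>+\<eta>. indicator {p. num_verts (snd (snd p)) = k - j} (\<eta> (Suc j)) *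
          (indicator {\<eta>. ?K \<eta> = Suc j} \<eta>) \<partial>?G)"
      by (rule nn_integral_sum) measurable
    also have "\<dots> = (\<Sum>j\<le>k. ennreal (?w (k - j)) * ennreal (fps_nth (size_fps W ^ m) j))"
    proof (rule sum.cong[OF refl])
      fix j
      have "(\<integral>\<^sup>+\<eta>. indicator {p. num_verts (snd (snd p)) = k - j} (\<eta> (Suc j)) *
          (indicator {\<eta>. ?K \<eta> = Suc j} \<eta>) \<partial>?G)
         = (\<integral>\<^sup>+p. indicator {p. num_verts (snd (snd p)) = k - j} p \<partial>mark_law W (Suc j)) *
           (\<integral>\<^sup>+\<eta>. indicator {\<eta>. ?K \<eta> = Suc j} \<eta> \<partial>?G)"
      proof (rule nn_integral_growth_space_indep)
        show "indicator {p. num_verts (snd (snd p)) = k - j} \<in> borel_measurable (mark_law W (Suc j))"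
          by (rule borel_measurable_indicator[OF sets_num_verts])
        show "(indicator {\<eta>. ?K \<eta> = Suc j} (\<eta>(Suc j := y)) :: ennreal) = indicator {\<eta>. ?K \<eta> = Suc j} \<eta>" for \<eta> y
          by (simp add: fst_jump_chain_upd_iff indicator_def)
      qed auto
      also have "(\<integral>\<^sup>+\<eta>. indicator {\<eta>. ?K \<eta> = Suc j} \<eta> \<partial>?G) = (\<integral>\<^sup>+\<eta>. indicator {\<eta> \<in> space ?G. ?K \<eta> = Suc j} \<eta> \<partial>?G)"
        by (rule nn_integral_cong) (auto simp: indicator_def)
      finally show "(\<integral>\<^sup>+\<eta>. indicator {p. num_verts (snd (snd p)) = k - j} (\<eta> (Suc j)) *
          (indicator {\<eta>. ?K \<eta> = Suc j} \<eta>) \<partial>?G) = ennreal (?w (k - j)) * ennreal (fps_nth (size_fps W ^ m) j)"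
        by (simp add: nn_integral_indicator[OF sets_num_verts] emeasure_mark_law_num_verts Suc.IH(1))
    qed
    also have "\<dots> = ennreal (\<Sum>j\<le>k. fps_nth (size_fps W ^ m) j * ?w (k - j))"
      by (subst sum_ennreal[symmetric]) (auto simp: Suc.IH(2) ennreal_mult mult.commute)
    also have "\<dots> = ennreal (fps_nth (size_fps W ^ Suc m) k)"
      by (simp only: power_Suc2 fps_mult_nth) (simp add: size_fps_def atMost_atLeast0)
    finally show ?case .
  next
    case 2
    show ?case by (simp only: power_Suc2 fps_mult_nth)
        (intro sum_nonneg mult_nonneg_nonneg Suc.IH(2), simp add: size_fps_def)
  }
qed

text \<open>While the chain has \<open>k + 1\<close> vertices, the waiting time is the one in the mark \<open>k + 1\<close>: it is
  independent of the event and has mean \<open>1 / (k + 1)\<close>.\<close>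

lemma nn_integral_waiting_time:
  "(\<integral>\<^sup>+\<eta>. ennreal (waiting_time \<eta> m) * indicator {\<eta>. fst (jump_chain \<eta> m) = Suc k} \<eta> \<partial>growth_space W)
     = ennreal (fps_nth (size_fps W ^ m) k / real (Suc k))"
proof -
  let ?A = "{\<eta>. fst (jump_chain \<eta> m) = Suc k}"
  have "(\<integral>\<^sup>+\<eta>. ennreal (waiting_time \<eta> m) * indicator ?A \<eta> \<partial>growth_space W)
      = (\<integral>\<^sup>+\<eta>. ennreal (fst (\<eta> (Suc k))) * indicator ?A \<eta> \<partial>growth_space W)"
    by (rule nn_integral_cong) (auto simp: waiting_time_def indicator_def)
  also have "\<dots> = (\<integral>\<^sup>+p. ennreal (fst p) \<partial>mark_law W (Suc k)) * (\<integral>\<^sup>+\<eta>. indicator ?A \<eta> \<partial>growth_space W)"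
    by (rule nn_integral_growth_space_indep) (auto simp: fst_jump_chain_upd_iff indicator_def)
  also have "(\<integral>\<^sup>+\<eta>. indicator ?A \<eta> \<partial>growth_space W)
      = (\<integral>\<^sup>+\<eta>. indicator {\<eta> \<in> space (growth_space W). fst (jump_chain \<eta> m) = Suc k} \<eta> \<partial>growth_space W)"
    by (rule nn_integral_cong) (auto simp: indicator_def)
  also have "\<dots> = ennreal (fps_nth (size_fps W ^ m) k)"
    by (subst nn_integral_indicator) (measurable, simp add: emeasure_chain_size)
  finally show ?thesis
    by (simp add: nn_integral_mark_law_time ennreal_mult[symmetric] size_fps_power_nonneg)
qed

section \<open>One copy observed at a uniform fraction of its lifetime\<close>

lemma waiting_time_pos: "good_marks \<eta> \<Longrightarrow> 0 < waiting_time \<eta> m"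
  using fst_jump_chain_pos[of \<eta> m] by (auto simp: good_marks_def waiting_time_def)

lemma jump_time_Suc: "jump_time \<eta> (Suc m) = jump_time \<eta> m + waiting_time \<eta> m"
  by (simp add: jump_time_def)

lemma jump_time_0: "jump_time \<eta> 0 = 0"
  by (simp add: jump_time_def)

lemma strict_mono_jump_time: "good_marks \<eta> \<Longrightarrow> strict_mono (jump_time \<eta>)"
  by (rule strict_monoI_Suc) (simp add: jump_time_Suc waiting_time_pos)

lemma jump_time_le_explosion_time: "ennreal (jump_time \<eta> m) \<le> explosion_time \<eta>"
  unfolding explosion_time_def by (rule SUP_upper) simp

lemma explosion_time_pos: "good_marks \<eta> \<Longrightarrow> 0 < explosion_time \<eta>"
  using jump_time_le_explosion_time[of \<eta> 1] waiting_time_pos[of \<eta> 0]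
  by (simp add: jump_time_def) (metis ennreal_less_zero_iff less_le_trans)

definition jumps_by :: "marks \<Rightarrow> real \<Rightarrow> nat" where
  "jumps_by \<eta> s = card {m. jump_time \<eta> m \<in> {0<..s}}"

lemma growth_process_between_jumps:
  assumes good: "good_marks \<eta>" and s: "jump_time \<eta> m \<le> s" "s < jump_time \<eta> (Suc m)"
  shows "growth_process \<eta> s = abs_rooted_graph (jump_chain \<eta> m)" and "jumps_by \<eta> s = m"
proof -
  note mono = strict_mono_jump_time[OF good]
  have "(LEAST j. s < jump_time \<eta> (Suc j)) = m"
  proof (rule Least_equality)
    fix j assume "s < jump_time \<eta> (Suc j)"
    then have "jump_time \<eta> m < jump_time \<eta> (Suc j)" using s by simp
    then show "m \<le> j" using strict_mono_less[OF mono] by simp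
  qed (rule s)
  then show "growth_process \<eta> s = abs_rooted_graph (jump_chain \<eta> m)"
    by (simp add: growth_process_def)
  have "{j. jump_time \<eta> j \<in> {0<..s}} = {1..m}"
  proof (intro set_eqI iffI)
    fix j assume "j \<in> {j. jump_time \<eta> j \<in> {0<..s}}"
    then have "jump_time \<eta> 0 < jump_time \<eta> j" "jump_time \<eta> j < jump_time \<eta> (Suc m)"
      using s by (auto simp: jump_time_0)
    then show "j \<in> {1..m}" using strict_mono_less[OF mono] by simp
  next
    fix j assume "j \<in> {1..m}"
    then have "jump_time \<eta> 0 < jump_time \<eta> j" "jump_time \<eta> j \<le> jump_time \<eta> m"
      using strict_mono_less[OF mono] strict_mono_less_eq[OF mono] by simp_all
    then show "j \<in> {j. jump_time \<eta> j \<in> {0<..s}}" using s by (simp add: jump_time_0)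
  qed
  then show "jumps_by \<eta> s = m" by (simp add: jumps_by_def)
qed

text \<open>Before the explosion every time lies between two consecutive jumps, and the number of jumps so far
  identifies the interval.\<close>

lemma size_and_jumps_iff:
  assumes good: "good_marks \<eta>" and fin: "explosion_time \<eta> < \<infinity>"
    and s: "0 \<le> s" "s < enn2real (explosion_time \<eta>)"
  shows "num_verts (growth_process \<eta> s) = k \<and> jumps_by \<eta> s = m \<longleftrightarrow>
    fst (jump_chain \<eta> m) = k \<and> jump_time \<eta> m \<le> s \<and> s < jump_time \<eta> (Suc m)"
proof -
  note mono = strict_mono_jump_time[OF good]
  define i where "i = (LEAST i. s < jump_time \<eta> i)"
  have "ennreal s < explosion_time \<eta>"
    using s fin by (cases "explosion_time \<eta>") (auto simp: ennreal_less_iff)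
  then obtain j where "s < jump_time \<eta> j"
    unfolding explosion_time_def less_SUP_iff using s by (auto simp: ennreal_less_iff)
  then have i: "s < jump_time \<eta> i" unfolding i_def by (rule LeastI)
  then obtain j where j: "i = Suc j" using s by (cases i) (auto simp: jump_time_0)
  have "\<not> s < jump_time \<eta> j" using not_less_Least[of j "\<lambda>i. s < jump_time \<eta> i"] by (auto simp: i_def[symmetric] j)
  then have sj: "jump_time \<eta> j \<le> s" "s < jump_time \<eta> (Suc j)" using i j by auto
  note bt = growth_process_between_jumps[OF good]
  show ?thesis
    using bt[OF sj] bt(2)[of m s] sj rooted_simple_graph_jump_chain[OF good]
    by (auto simp: num_verts_abs)
qed

text \<open>If the chain has \<open>k\<close> vertices after \<open>m\<close> jumps then, up to the null event \<open>u = 1\<close>, the positions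
  \<open>u\<close> counted on the left form the interval between the jumps \<open>m\<close> and \<open>m + 1\<close>, rescaled by the
  lifetime.  The factor in front, which is the size bias,
  turns its length back into the waiting time.\<close>

lemma nn_integral_uniform_position:
  assumes good: "good_marks \<eta>" and fin: "explosion_time \<eta> < \<infinity>"
  defines "L \<equiv> enn2real (explosion_time \<eta>)"
  shows "explosion_time \<eta> * (\<integral>\<^sup>+u. indicator {u. num_verts (growth_process \<eta> (u * L)) = k \<and> jumps_by \<eta> (u * L) = m} u
            \<partial>uniform_measure lborel {0..1})
       = ennreal (waiting_time \<eta> m) * indicator {\<eta>. fst (jump_chain \<eta> m) = k} \<eta>"
proof -
  note mono = strict_mono_jump_time[OF good]
  have T: "explosion_time \<eta> = ennreal L" using fin by (simp add: L_def)
  have L: "0 < L" using explosion_time_pos[OF good] T by simp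
  have J: "jump_time \<eta> i \<le> L" "0 \<le> jump_time \<eta> i" for i
    using jump_time_le_explosion_time[of \<eta> i] strict_mono_less_eq[OF mono, of 0 i] T L
    by (auto simp: jump_time_0)
  let ?A = "{u. num_verts (growth_process \<eta> (u * L)) = k \<and> jumps_by \<eta> (u * L) = m}"
  let ?I = "{jump_time \<eta> m / L ..< jump_time \<eta> (Suc m) / L}"
  define c :: ennreal where "c = indicator {\<eta>. fst (jump_chain \<eta> m) = k} \<eta>"
  have ae: "AE u in lborel. (indicator ?A u * indicator {0..1} u :: ennreal) = c * indicator ?I u"
    using AE_lborel_singleton[of 1]
  proof eventually_elim
    fix u :: real assume u: "u \<noteq> 1"
    show "(indicator ?A u * indicator {0..1} u :: ennreal) = c * indicator ?I u"
    proof (cases "0 \<le> u \<and> u < 1")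
      case True
      then have "0 \<le> u * L" "u * L < L" using L by auto
      then have "u \<in> ?A \<longleftrightarrow> fst (jump_chain \<eta> m) = k \<and> jump_time \<eta> m \<le> u * L \<and> u * L < jump_time \<eta> (Suc m)"
        using size_and_jumps_iff[OF good fin, of "u * L" k m] by (simp add: L_def)
      also have "\<dots> \<longleftrightarrow> fst (jump_chain \<eta> m) = k \<and> u \<in> ?I" using L by (simp add: field_simps)
      finally show ?thesis using True by (simp add: c_def indicator_def)
    next
      case False
      have "u \<notin> ?I"
      proof
        assume "u \<in> ?I"
        then have "jump_time \<eta> m \<le> u * L" "u * L < jump_time \<eta> (Suc m)" using L by (auto simp: field_simps)
        then have "0 \<le> u * L" "u * L < L" using J(2)[of m] J(1)[of "Suc m"] by linarith+
        then show False using False L mult_right_mono[of 1 u L] by (simp add: zero_le_mult_iff)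
      qed
      then show ?thesis using False u by (auto simp: indicator_def)
    qed
  qed
  have ae2: "AE u in lborel. u \<in> {0..1} \<longrightarrow> (indicator ?A u :: ennreal) = c * indicator ?I u"
    using ae by eventually_elim (auto simp: indicator_def)
  have "(\<integral>\<^sup>+u. indicator ?A u \<partial>uniform_measure lborel {0..1})
      = (\<integral>\<^sup>+u. c * indicator ?I u \<partial>uniform_measure lborel {0..1})"
    by (rule nn_integral_cong_AE, rule AE_uniform_measureI) (use ae2 in auto)
  also have "\<dots> = (\<integral>\<^sup>+u. c * indicator ?I u * indicator {0..1} u \<partial>lborel)"
    by (subst nn_integral_uniform_measure) (auto simp: divide_ennreal_def)
  also have "\<dots> = (\<integral>\<^sup>+u. c * indicator ?I u \<partial>lborel)"
  proof (rule nn_integral_cong)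
    fix u
    have "0 \<le> jump_time \<eta> m / L" "jump_time \<eta> (Suc m) / L \<le> 1"
      using J(2)[of m] J(1)[of "Suc m"] L by simp_all
    then show "c * indicator ?I u * indicator {0..1} u = c * indicator ?I u"
      by (simp add: indicator_def)
  qed
  also have "\<dots> = c * ennreal (waiting_time \<eta> m / L)"
  proof -
    have "jump_time \<eta> m / L \<le> jump_time \<eta> (Suc m) / L"
      using L waiting_time_pos[OF good, of m] by (simp add: divide_right_mono jump_time_Suc)
    then show ?thesis using L by (simp add: nn_integral_cmult jump_time_Suc diff_divide_distrib[symmetric])
  qed
  finally show ?thesis using L waiting_time_pos[OF good, of m]
    by (simp add: T c_def[symmetric] mult.left_commute ennreal_mult[symmetric] less_imp_le mult.commute)
qed

lemma measurable_jumps_by [measurable]: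
  "(\<lambda>(\<eta>, s). jumps_by \<eta> s) \<in> growth_space W \<Otimes>\<^sub>M borel \<rightarrow>\<^sub>M count_space UNIV"
proof -
  have [measurable]: "(\<lambda>p. jump_time (fst p) m) \<in> borel_measurable (growth_space W \<Otimes>\<^sub>M borel)" for m
    by (rule measurable_compose[OF measurable_fst measurable_jump_time])
  show ?thesis
    unfolding jumps_by_def case_prod_beta greaterThanAtMost_iff by measurable
qed

section \<open>The stationary process at time zero\<close>

lemma theta_Suc: "theta \<omega> (i + 1) = theta \<omega> i + lifetime \<omega> i"
proof -
  consider "0 \<le> i" | "i = -1" | "i < -1" by linarith
  then show ?thesis
  proof cases
    case 1
    then have "{0..<i + 1} = insert i {0..<i}" by auto
    then show ?thesis using 1 by (simp add: theta_def)
  next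
    case 2
    have "{-1..<0::int} = {-1}" by auto
    then show ?thesis using 2 by (simp add: theta_def)
  next
    case 3
    then have "{i..<0} = insert i {i + 1..<0}" by auto
    then show ?thesis using 3 by (simp add: theta_def)
  qed
qed

lemma theta_mono: "i \<le> j \<Longrightarrow> theta \<omega> i \<le> theta \<omega> j"
  by (induction j rule: int_ge_induct) (auto simp: theta_Suc lifetime_def intro: order_trans)

text \<open>Lifetimes are nonnegative everywhere, not just almost surely, so uniqueness holds at every point of
  the sample space.  Measurability of the current copy depends on this, because the value of a
  definite description with several candidates could vary with the predicate in any way.\<close>

lemma current_copy_unique:
  assumes "theta \<omega> i \<le> t" "t < theta \<omega> (i + 1)" "theta \<omega> j \<le> t" "t < theta \<omega> (j + 1)"
  shows "i = j"
  using assms theta_mono[of "i + 1" j \<omega>] theta_mono[of "j + 1" i \<omega>] by linarith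

lemma sets_size_biased [measurable_cong]: "sets (size_biased_growth_space W) = sets (growth_space W)"
  by (simp add: size_biased_growth_space_def)

lemma space_size_biased: "space (size_biased_growth_space W) = space (growth_space W)"
  by (simp add: size_biased_growth_space_def)

lemma measurable_copy [measurable]:
  "(\<lambda>\<omega>. fst \<omega> i) \<in> stationary_space W \<rightarrow>\<^sub>M growth_space W"
proof -
  let ?M = "\<lambda>i::int. if i = 0 then size_biased_growth_space W else growth_space W"
  have "(\<lambda>\<omega>. \<omega> i) \<in> Pi\<^sub>M UNIV ?M \<rightarrow>\<^sub>M ?M i" by (rule measurable_component_singleton) simp
  moreover have "sets (?M i) = sets (growth_space W)" using sets_size_biased by (cases "i = 0") auto
  ultimately have "(\<lambda>\<omega>. \<omega> i) \<in> Pi\<^sub>M UNIV ?M \<rightarrow>\<^sub>M growth_space W"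
    by (subst measurable_cong_sets[OF refl, symmetric])
  then show ?thesis unfolding stationary_space_def by (rule measurable_compose[OF measurable_fst])
qed

lemma measurable_position [measurable]: "snd \<in> borel_measurable (stationary_space W)"
  unfolding stationary_space_def by (rule measurable_compose[OF measurable_snd]) simp

lemma measurable_lifetime [measurable]: "(\<lambda>\<omega>. lifetime \<omega> i) \<in> borel_measurable (stationary_space W)"
  unfolding lifetime_def by measurable

lemma measurable_theta [measurable]: "(\<lambda>\<omega>. theta \<omega> i) \<in> borel_measurable (stationary_space W)"
  unfolding theta_def by measurable

lemma measurable_current_copy [measurable]:
  "(\<lambda>\<omega>. current_copy \<omega> t) \<in> stationary_space W \<rightarrow>\<^sub>M count_space UNIV"
  unfolding current_copy_def
  by (rule measurable_THE[where I = UNIV]) (auto intro: current_copy_unique)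

lemma measurable_cluster_process [measurable]:
  "(\<lambda>\<omega>. cluster_process \<omega> t) \<in> stationary_space W \<rightarrow>\<^sub>M count_space UNIV"
proof -
  have "(\<lambda>\<omega>. growth_process (fst \<omega> i) (t - theta \<omega> i)) \<in> stationary_space W \<rightarrow>\<^sub>M count_space UNIV" for i
  proof -
    have "(\<lambda>\<omega>. (fst \<omega> i, t - theta \<omega> i)) \<in> stationary_space W \<rightarrow>\<^sub>M growth_space W \<Otimes>\<^sub>M borel" by measurable
    from measurable_compose[OF this measurable_growth_process] show ?thesis by simp
  qed
  then show ?thesis unfolding cluster_process_def Let_def
    by (rule measurable_compose_countable) measurable
qed

lemma measurable_num_jumps [measurable]:
  "(\<lambda>\<omega>. num_jumps \<omega> t) \<in> stationary_space W \<rightarrow>\<^sub>M count_space UNIV"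
proof -
  have "(\<lambda>\<omega>. card {m. theta \<omega> i + jump_time (fst \<omega> i) m \<in> {theta \<omega> i<..t}})
      \<in> stationary_space W \<rightarrow>\<^sub>M count_space UNIV" for i
    unfolding greaterThanAtMost_iff by measurable
  then show ?thesis unfolding num_jumps_def Let_def
    by (rule measurable_compose_countable) measurable
qed

text \<open>Only copy \<open>0\<close> matters: it is the one alive at time \<open>0\<close>, at age \<open>u L\<close> for lifetime \<open>L\<close> and relative
  position \<open>u\<close>.\<close>

lemma at_time_0:
  assumes good: "good_marks (fst \<omega> 0)" and fin: "explosion_time (fst \<omega> 0) < \<infinity>"
    and u: "0 \<le> snd \<omega>" "snd \<omega> < 1"
  shows "cluster_process \<omega> 0 = growth_process (fst \<omega> 0) (snd \<omega> * enn2real (explosion_time (fst \<omega> 0)))"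
    and "num_jumps \<omega> 0 = jumps_by (fst \<omega> 0) (snd \<omega> * enn2real (explosion_time (fst \<omega> 0)))"
proof -
  have L: "0 < lifetime \<omega> 0"
    using explosion_time_pos[OF good] fin by (simp add: lifetime_def enn2real_positive_iff)
  have th: "theta \<omega> 0 = - (snd \<omega> * lifetime \<omega> 0)" by (simp add: theta_def)
  have "theta \<omega> 0 \<le> 0 \<and> 0 < theta \<omega> (0 + 1)"
    unfolding theta_Suc th using u L by simp
  then have cur: "current_copy \<omega> 0 = 0"
    unfolding current_copy_def by (intro the_equality) (auto intro: current_copy_unique)
  show "cluster_process \<omega> 0 = growth_process (fst \<omega> 0) (snd \<omega> * enn2real (explosion_time (fst \<omega> 0)))"
    by (simp add: cluster_process_def Let_def cur th) (simp add: lifetime_def)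
  show "num_jumps \<omega> 0 = jumps_by (fst \<omega> 0) (snd \<omega> * enn2real (explosion_time (fst \<omega> 0)))"
    by (simp add: num_jumps_def Let_def cur th jumps_by_def) (simp add: lifetime_def)
qed

lemma mean_explosion_time_pos: "0 < mean_explosion_time W"
proof (rule ccontr)
  interpret prob_space "growth_space W" by (rule prob_space_growth_space)
  assume "\<not> 0 < mean_explosion_time W"
  then have "AE \<eta> in growth_space W. explosion_time \<eta> = 0"
    by (simp add: mean_explosion_time_def nn_integral_0_iff_AE)
  with AE_good_marks have "AE \<eta> in growth_space W. False"
    by eventually_elim (use explosion_time_pos in fastforce)
  then show False by simp
qed

lemma prob_space_size_biased:
  assumes "mean_explosion_time W < \<infinity>"
  shows "prob_space (size_biased_growth_space W)"
proof
  have "emeasure (size_biased_growth_space W) (space (size_biased_growth_space W))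
      = (\<integral>\<^sup>+\<eta>. explosion_time \<eta> / mean_explosion_time W \<partial>growth_space W)"
    unfolding space_size_biased unfolding size_biased_growth_space_def
    by (subst emeasure_density) (auto intro!: nn_integral_cong)
  also have "\<dots> = mean_explosion_time W / mean_explosion_time W"
    by (simp add: nn_integral_divide mean_explosion_time_def)
  also have "\<dots> = 1" using assms mean_explosion_time_pos[of W] by (simp add: ennreal_divide_self)
  finally show "emeasure (size_biased_growth_space W) (space (size_biased_growth_space W)) = 1" .
qed

text \<open>The density of the size-biased law cancels the normalisation by the lifetime, which leaves
  the mean time that an ordinary copy spends at size \<open>k + 1\<close> after \<open>m\<close> jumps, divided by the mean
  lifetime.\<close>

lemma emeasure_size_and_jumps:
  assumes mean: "mean_explosion_time W < \<infinity>"
    and expl: "AE \<eta> in growth_space W. explosion_time \<eta> < \<infinity>"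
  shows "emeasure (stationary_space W) {\<omega> \<in> space (stationary_space W).
      num_verts (cluster_process \<omega> 0) = Suc k \<and> num_jumps \<omega> 0 = m}
    = ennreal (fps_nth (size_fps W ^ m) k / real (Suc k)) / mean_explosion_time W"
proof -
  let ?G = "growth_space W" and ?B = "size_biased_growth_space W" and ?S = "stationary_space W"
  let ?mu = "mean_explosion_time W"
  define M where "M i = (if i = 0 then ?B else ?G)" for i :: int
  define C where "C = Pi\<^sub>M UNIV M"
  define U where "U = uniform_measure lborel {0..1::real}"
  have S: "?S = C \<Otimes>\<^sub>M U" by (simp add: stationary_space_def C_def M_def[abs_def] U_def)
  have pM: "prob_space (M i)" for i
    using prob_space_size_biased[OF mean] prob_space_growth_space by (simp add: M_def)
  interpret C: prob_space C unfolding C_def by (intro prob_space_PiM pM)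
  interpret U: prob_space U unfolding U_def by (intro prob_space_uniform_measure) auto
  have setsU [measurable_cong]: "sets U = sets borel" by (simp add: U_def)
  have C0: "(\<lambda>c. c 0) \<in> C \<rightarrow>\<^sub>M ?B"
    using measurable_component_singleton[of 0 UNIV M] by (simp add: C_def M_def)
  have distr0: "distr C ?B (\<lambda>c. c 0) = ?B"
  proof -
    have "distr C (M 0) (\<lambda>c. c 0) = M 0"
      unfolding C_def by (rule distr_PiM_component) (auto intro: pM)
    then show ?thesis by (simp add: M_def)
  qed
  \<comment> \<open>The event, as a function of copy \<open>0\<close> and of the relative position alone.\<close>
  define \<Phi> :: "marks \<Rightarrow> real \<Rightarrow> ennreal" where
    "\<Phi> \<eta> = (\<lambda>u. indicator {u. num_verts (growth_process \<eta> (u * enn2real (explosion_time \<eta>))) = Suc k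
        \<and> jumps_by \<eta> (u * enn2real (explosion_time \<eta>)) = m} u)" for \<eta>
  have \<Phi> [measurable]: "(\<lambda>(\<eta>, u). \<Phi> \<eta> u) \<in> borel_measurable (?G \<Otimes>\<^sub>M U)"
  proof -
    have "(\<lambda>p. (fst p, snd p * enn2real (explosion_time (fst p)))) \<in> ?G \<Otimes>\<^sub>M U \<rightarrow>\<^sub>M ?G \<Otimes>\<^sub>M borel"
      by measurable
    note [measurable] = measurable_compose[OF this measurable_growth_process]
      measurable_compose[OF this measurable_jumps_by]
    show ?thesis unfolding \<Phi>_def case_prod_beta by measurable
  qed
  let ?E = "{\<omega> \<in> space ?S. num_verts (cluster_process \<omega> 0) = Suc k \<and> num_jumps \<omega> 0 = m}"
  have E: "?E \<in> sets ?S" by measurable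
  have "emeasure ?S ?E = (\<integral>\<^sup>+\<omega>. indicator ?E \<omega> \<partial>(C \<Otimes>\<^sub>M U))"
    using E by (simp add: S)
  also have "\<dots> = (\<integral>\<^sup>+c. \<integral>\<^sup>+u. indicator ?E (c, u) \<partial>U \<partial>C)"
    using E by (intro U.nn_integral_fst[symmetric]) (simp add: S)
  also have "\<dots> = (\<integral>\<^sup>+c. \<integral>\<^sup>+u. \<Phi> (c 0) u \<partial>U \<partial>C)"
  proof (rule nn_integral_cong_AE)
    have "AE \<eta> in ?B. good_marks \<eta> \<and> explosion_time \<eta> < \<infinity>"
      unfolding size_biased_growth_space_def
      using AE_good_marks[of W] expl by (subst AE_density) auto
    moreover have "M 0 = ?B" by (simp add: M_def)
    ultimately have "AE \<eta> in M 0. good_marks \<eta> \<and> explosion_time \<eta> < \<infinity>" by (simp only:)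
    then have "AE c in C. good_marks (c 0) \<and> explosion_time (c 0) < \<infinity>"
      unfolding C_def by (rule AE_PiM_component[OF pM UNIV_I])
    then show "AE c in C. (\<integral>\<^sup>+u. indicator ?E (c, u) \<partial>U) = (\<integral>\<^sup>+u. \<Phi> (c 0) u \<partial>U)"
      using AE_space
    proof eventually_elim
      fix c assume c: "good_marks (c 0) \<and> explosion_time (c 0) < \<infinity>" "c \<in> space C"
      have "AE u in U. 0 \<le> u \<and> u < 1"
        unfolding U_def
        by (rule AE_uniform_measureI) (use AE_lborel_singleton[of 1] in \<open>auto elim!: eventually_mono\<close>)
      then have "AE u in U. indicator ?E (c, u) = \<Phi> (c 0) u"
      proof eventually_elim
        fix u assume u: "0 \<le> u \<and> u < (1::real)"
        have "(c, u) \<in> space ?S" using c by (simp add: S space_pair_measure U_def)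
        then show "indicator ?E (c, u) = \<Phi> (c 0) u"
          using at_time_0[of "(c, u)"] c u by (simp add: \<Phi>_def indicator_def)
      qed
      then show "(\<integral>\<^sup>+u. indicator ?E (c, u) \<partial>U) = (\<integral>\<^sup>+u. \<Phi> (c 0) u \<partial>U)"
        by (rule nn_integral_cong_AE)
    qed
  qed
  also have "\<dots> = (\<integral>\<^sup>+\<eta>. \<integral>\<^sup>+u. \<Phi> \<eta> u \<partial>U \<partial>?B)"
    by (subst distr0[symmetric], subst nn_integral_distr[OF C0]) auto
  also have "\<dots> = (\<integral>\<^sup>+\<eta>. explosion_time \<eta> / ?mu * (\<integral>\<^sup>+u. \<Phi> \<eta> u \<partial>U) \<partial>?G)"
    unfolding size_biased_growth_space_def by (subst nn_integral_density) auto
  also have "\<dots> = (\<integral>\<^sup>+\<eta>. ennreal (waiting_time \<eta> m) * indicator {\<eta>. fst (jump_chain \<eta> m) = Suc k} \<eta> / ?mu \<partial>?G)"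
  proof (rule nn_integral_cong_AE)
    show "AE \<eta> in ?G. explosion_time \<eta> / ?mu * (\<integral>\<^sup>+u. \<Phi> \<eta> u \<partial>U) =
        ennreal (waiting_time \<eta> m) * indicator {\<eta>. fst (jump_chain \<eta> m) = Suc k} \<eta> / ?mu"
      using AE_good_marks expl
    proof eventually_elim
      fix \<eta> assume \<eta>: "good_marks \<eta>" "explosion_time \<eta> < \<infinity>"
      show "explosion_time \<eta> / ?mu * (\<integral>\<^sup>+u. \<Phi> \<eta> u \<partial>U) =
        ennreal (waiting_time \<eta> m) * indicator {\<eta>. fst (jump_chain \<eta> m) = Suc k} \<eta> / ?mu"
        unfolding nn_integral_uniform_position[OF \<eta>, of "Suc k" m, symmetric]
        by (simp add: \<Phi>_def U_def divide_ennreal_def ac_simps)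
    qed
  qed
  also have "\<dots> = (\<integral>\<^sup>+\<eta>. ennreal (waiting_time \<eta> m) * indicator {\<eta>. fst (jump_chain \<eta> m) = Suc k} \<eta> \<partial>?G) / ?mu"
    by (rule nn_integral_divide) measurable
  finally show ?thesis by (simp only: nn_integral_waiting_time)
qed

section \<open>The generating function equations\<close>

text \<open>The geometric series in \<open>a\<close>, summed coefficientwise.  The sums are finite because \<open>a\<^sup>m\<close> starts in
  degree \<open>m\<close>.\<close>

lemma fps_geometric_mult:
  fixes a :: "'a::field fps"
  assumes a: "fps_nth a 0 = 0"
  shows "Abs_fps (\<lambda>k. \<Sum>m\<le>k. fps_nth (a ^ m) k) * (1 - a) = 1"
proof -
  let ?g = "Abs_fps (\<lambda>_. 1 :: 'a)"
  have "Abs_fps (\<lambda>k. \<Sum>m\<le>k. fps_nth (a ^ m) k) = fps_compose ?g a"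
    by (simp add: fps_eq_iff fps_compose_nth atMost_atLeast0)
  moreover have "1 - a = fps_compose (1 - fps_X) a"
    by (simp add: fps_compose_sub_distrib fps_X_fps_compose_startby0 a)
  moreover have "?g * (1 - fps_X) = 1"
    using fps_inverse_gp' by (simp add: fps_eq_iff fps_mult_fps_X_commute right_diff_distrib split: nat.split)
  ultimately show ?thesis
    by (simp add: fps_compose_mult_distrib[OF a, symmetric])
qed

definition fps_complex :: "real fps \<Rightarrow> complex fps" where
  "fps_complex f = Abs_fps (\<lambda>k. of_real (fps_nth f k))"

lemma fps_nth_fps_complex [simp]: "fps_nth (fps_complex f) k = of_real (fps_nth f k)"
  by (simp add: fps_complex_def)

lemma fps_complex_mult: "fps_complex (f * g) = fps_complex f * fps_complex g"
  by (simp add: fps_eq_iff fps_mult_nth)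

lemma fps_complex_power: "fps_complex (f ^ m) = fps_complex f ^ m"
proof (induction m)
  case 0
  show ?case by (simp add: fps_eq_iff)
qed (simp add: fps_complex_mult)

lemma fps_conv_radius_ge_1:
  fixes f :: "complex fps"
  assumes "\<And>k. norm (fps_nth f k) \<le> 1"
  shows "fps_conv_radius f \<ge> 1"
  unfolding fps_conv_radius_def
proof (rule conv_radius_geI_ex)
  fix r :: real assume r: "0 < r" "ereal r < 1"
  have "summable (\<lambda>k. fps_nth f k * of_real r ^ k)"
  proof (rule summable_comparison_test)
    show "\<exists>N. \<forall>n\<ge>N. norm (fps_nth f n * of_real r ^ n) \<le> r ^ n"
      using assms r by (auto simp: norm_mult norm_power intro!: mult_left_le_one_le)
    show "summable (\<lambda>n. r ^ n)" using r by (simp add: summable_geometric)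
  qed
  then show "\<exists>z. norm z = r \<and> summable (\<lambda>k. fps_nth f k * z ^ k)"
    using r by (intro exI[of _ "of_real r"]) simp
qed

text \<open>The balance equation is \<open>\<mu> w' = \<Sum>m. w\<^sup>m\<close>, a geometric series.  Multiplied by \<open>1 - w\<close> it becomes
  half the derivative of the second equation, and both sides of that one have no constant term.\<close>

lemma steady_state_size_equation:
  fixes w :: "real fps" and \<mu> :: real
  assumes w0: "fps_nth w 0 = 0"
    and balance: "\<And>k. \<mu> * real (Suc k) * fps_nth w (Suc k) = (\<Sum>m\<le>k. fps_nth (w ^ m) k)"
  shows "fps_const \<mu> * fps_deriv w * (1 - w) = 1"
    and "fps_const \<mu> * (2 * w - w\<^sup>2) = 2 * fps_X"
proof -
  have "fps_const \<mu> * fps_deriv w = Abs_fps (\<lambda>k. \<Sum>m\<le>k. fps_nth (w ^ m) k)"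
    by (simp add: fps_eq_iff balance[symmetric] mult.assoc del: of_nat_Suc)
  then show 1: "fps_const \<mu> * fps_deriv w * (1 - w) = 1"
    using fps_geometric_mult[OF w0] by simp
  have "fps_deriv (fps_const \<mu> * (2 * w - w\<^sup>2)) = 2 * (fps_const \<mu> * fps_deriv w * (1 - w))"
    by (simp add: power2_eq_square algebra_simps)
  also have "\<dots> = fps_deriv (2 * fps_X)" by (simp add: 1)
  finally have "fps_deriv (fps_const \<mu> * (2 * w - w\<^sup>2)) = fps_deriv (2 * fps_X)" .
  from fps_deriv_eq_iff[THEN iffD1, OF this] show "fps_const \<mu> * (2 * w - w\<^sup>2) = 2 * fps_X"
    by (simp add: w0 power2_eq_square fps_mult_nth_0)
qed

text \<open>Adding up all coefficients evaluates the equation at \<open>z = 1\<close>, where \<open>2 w - w\<^sup>2 = 1\<close>.  The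
  product may be evaluated there because the coefficients are absolutely summable.\<close>

lemma mean_eq_2:
  fixes w :: "real fps" and \<mu> :: real
  assumes nonneg: "\<And>k. 0 \<le> fps_nth w k" and total: "fps_nth w sums 1"
    and eq: "fps_const \<mu> * (2 * w - w\<^sup>2) = 2 * fps_X"
  shows "\<mu> = 2"
proof -
  have sw: "summable (\<lambda>k. norm (fps_nth w k))" using total nonneg by (simp add: sums_iff)
  have "(\<lambda>k. fps_nth (w\<^sup>2) k) sums (1 * 1)"
    using Cauchy_product_sums[OF sw sw] total
    by (simp add: power2_eq_square fps_mult_nth atMost_atLeast0 sums_iff)
  then have "(\<lambda>k. \<mu> * (2 * fps_nth w k - fps_nth (w\<^sup>2) k)) sums (\<mu> * (2 * 1 - 1 * 1))"
    by (intro sums_mult sums_diff total)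
  moreover have "\<mu> * (2 * fps_nth w k - fps_nth (w\<^sup>2) k) = fps_nth (fps_const \<mu> * (2 * w - w\<^sup>2)) k" for k
    by (simp add: fps_mult_numeral_left)
  ultimately have "(\<lambda>k. fps_nth (2 * fps_X :: real fps) k) sums \<mu>" by (simp add: eq)
  moreover have "(\<lambda>k. fps_nth (2 * fps_X :: real fps) k) sums 2"
    using sums_single[of 1 "\<lambda>_. 2 :: real"] by (simp add: fps_X_def fps_mult_numeral_left if_distrib cong: if_cong)
  ultimately show ?thesis by (rule sums_unique2)
qed

text \<open>This keeps \<open>1 - w(z)\<close> and \<open>1 - x w(z)\<close> in the right half plane for \<open>\<bar>z\<bar> < 1\<close>, where the principal
  branches of the square root and of the logarithm are the correct ones.\<close>

lemma norm_eval_fps_le: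
  fixes w :: "real fps" and z :: complex
  assumes nonneg: "\<And>k. 0 \<le> fps_nth w k" and total: "fps_nth w sums 1" and w0: "fps_nth w 0 = 0"
    and z: "norm z \<le> 1"
  shows "norm (eval_fps (fps_complex w) z) \<le> norm z"
proof -
  have le: "norm (fps_nth (fps_complex w) k * z ^ k) \<le> fps_nth w k * norm z" for k
  proof (cases k)
    case (Suc j)
    have "norm z ^ Suc j \<le> norm z ^ 1" using z by (intro power_decreasing) auto
    then show ?thesis using nonneg[of k] Suc by (simp add: norm_mult norm_power mult_left_mono)
  qed (simp add: w0)
  have s: "(\<lambda>k. fps_nth w k * norm z) sums (1 * norm z)" by (intro sums_mult2 total)
  show ?thesis unfolding eval_fps_def
    using norm_suminf_le[OF le sums_summable[OF s]] s by (simp add: sums_iff)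
qed

text \<open>Both sides are compared through their derivatives in \<open>z\<close>.  That of the power series is
  \<open>1 / (2 (1 - x w))\<close> by the geometric series; that of the closed form is the same because
  \<open>2 w' (1 - w) = 1\<close>.\<close>

lemma jump_generating_function:
  fixes w :: "real fps" and \<mu> :: real and z x I :: complex
  assumes nonneg: "\<And>k m. 0 \<le> fps_nth (w ^ m) k" and total: "fps_nth w sums 1" and w0: "fps_nth w 0 = 0"
    and balance: "\<And>k. \<mu> * real (Suc k) * fps_nth w (Suc k) = (\<Sum>m\<le>k. fps_nth (w ^ m) k)"
    and z: "norm z < 1" and x: "x \<noteq> 0" "norm x \<le> 1"
    and I: "(\<lambda>k. z ^ Suc k * (\<Sum>m\<le>k. x ^ m * of_real (fps_nth (w ^ m) k)) / of_real (\<mu> * real (Suc k))) sums I"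
  defines "W \<equiv> 1 - csqrt (1 - z)"
  shows "I = 1 / x * (W + (1 - x) / x * Ln (1 - x * W))"
proof -
  have nonneg1: "0 \<le> fps_nth w k" for k using nonneg[where m = 1 and k = k] by simp
  note eq = steady_state_size_equation[OF w0 balance]
  have mu: "\<mu> = 2" using mean_eq_2[OF nonneg1 total eq(2)] .
  define v where "v = fps_complex w"
  define c where "c = Abs_fps (\<lambda>k. \<Sum>m\<le>k. x ^ m * of_real (fps_nth (w ^ m) k))"
  \<comment> \<open>The power series on the left; the constant 2 is the value of \<open>\<mu>\<close>.\<close>
  define F where "F = Abs_fps (\<lambda>k. if k = 0 then 0 else fps_nth c (k - 1) / (2 * of_nat k))"
  have w_le: "fps_nth w k \<le> 1" for k
    using sum_le_suminf[of "fps_nth w" "{k}"] total nonneg1 by (simp add: sums_iff)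
  \<comment> \<open>The case \<open>x = 1\<close>, where the coefficients of \<open>F\<close> are those of \<open>w\<close>, dominates all others.
    This gives convergence of \<open>F\<close> in the unit disc.\<close>
  have c_le: "norm (fps_nth c k) \<le> 2 * real (Suc k) * fps_nth w (Suc k)" for k
  proof -
    have "norm (fps_nth c k) \<le> (\<Sum>m\<le>k. fps_nth (w ^ m) k)"
      unfolding c_def fps_nth_Abs_fps
    proof (rule sum_norm_le)
      fix m
      have "norm x ^ m \<le> 1" using x by (simp add: power_le_one)
      then show "norm (x ^ m * of_real (fps_nth (w ^ m) k)) \<le> fps_nth (w ^ m) k"
        using nonneg[of m k] by (simp add: norm_mult norm_power mult_left_le_one_le)
    qed
    then show ?thesis by (simp only: balance[symmetric] mu)
  qed
  have "norm (fps_nth F k) \<le> 1" for k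
  proof (cases k)
    case (Suc j)
    have "norm (fps_nth F k) = norm (fps_nth c j) / (2 * real (Suc j))"
      by (simp add: F_def Suc norm_divide norm_mult del: of_nat_Suc)
    also have "\<dots> \<le> fps_nth w (Suc j)"
      using c_le[of j] by (simp add: divide_le_eq mult.commute del: of_nat_Suc)
    finally show ?thesis using w_le[of "Suc j"] by simp
  qed (simp add: F_def)
  then have rF: "fps_conv_radius F \<ge> 1" by (rule fps_conv_radius_ge_1)
  have cF: "c = 2 * fps_deriv F" by (simp add: fps_eq_iff F_def fps_mult_numeral_left del: of_nat_Suc)
  have rv: "fps_conv_radius v \<ge> 1"
    using nonneg1 w_le by (intro fps_conv_radius_ge_1) (simp add: v_def)
  have in_disc: "ereal (norm y) < fps_conv_radius F" "ereal (norm y) < fps_conv_radius v" if "norm y < 1" for y :: complex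
    using that rF rv by (metis ereal_less(3) less_ereal.simps(1) less_le_trans one_ereal_def)+
  have rdF: "ereal (norm y) < fps_conv_radius (fps_deriv F)" "ereal (norm y) < fps_conv_radius (fps_deriv v)"
    if "norm y < 1" for y :: complex
    using in_disc[OF that] fps_conv_radius_deriv[of F] fps_conv_radius_deriv[of v] by (auto intro: less_le_trans)
  have v0: "fps_nth v 0 = 0" by (simp add: v_def w0)
  have c_eq: "c * (1 - fps_const x * v) = 1"
  proof -
    have "c = Abs_fps (\<lambda>k. \<Sum>m\<le>k. fps_nth ((fps_const x * v) ^ m) k)"
      by (simp add: c_def v_def power_mult_distrib fps_const_power fps_complex_power[symmetric])
    then show ?thesis using fps_geometric_mult[of "fps_const x * v"] v0 by simp
  qed
  have v_eq: "2 * v - v * v = fps_X"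
  proof -
    have "2 * (2 * w - w * w) = 2 * fps_X"
      using eq(2) by (simp only: mu power2_eq_square numeral_fps_const)
    then have "2 * w - w * w = fps_X" by (simp only: mult_cancel_left) simp
    then have "2 * fps_nth w k - fps_nth (w * w) k = fps_nth fps_X k" for k
      using fps_mult_numeral_left[of _ w k] by (metis fps_sub_nth)
    then have "of_real (2 * fps_nth w k - fps_nth (w * w) k) = (of_real (fps_nth fps_X k) :: complex)" for k
      by simp
    then show ?thesis
      by (simp add: fps_eq_iff v_def fps_complex_mult[symmetric] fps_mult_numeral_left fps_X_def)
  qed
  have dv_eq: "2 * fps_deriv v * (1 - v) = 1"
    using arg_cong[OF v_eq, of fps_deriv] by (simp add: algebra_simps)
  let ?V = "eval_fps v" and ?D = "eval_fps (fps_deriv v)"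
  have V_less: "norm (?V y) < 1" if "norm y < 1" for y
    using norm_eval_fps_le[OF nonneg1 total w0, of y] that by (simp add: v_def)
  have xV_less: "norm (x * ?V y) < 1" if "norm y < 1" for y
    using V_less[OF that] x by (simp add: norm_mult) (meson le_less_trans mult_left_le_one_le norm_ge_zero)
  have V_sq: "(1 - ?V y)\<^sup>2 = 1 - y" if y: "norm y < 1" for y
  proof -
    have "eval_fps (2 * v - v * v) y = 2 * ?V y - ?V y * ?V y"
      using in_disc[OF y] fps_conv_radius_mult[of v v] fps_conv_radius_mult[of 2 v]
      by (subst eval_fps_diff) (auto simp: eval_fps_mult min_def intro: less_le_trans)
    then show ?thesis unfolding v_eq by (simp add: power2_eq_square algebra_simps)
  qed
  have V_csqrt: "?V z = W"
  proof -
    have "Re (?V z) < 1" using V_less[OF z] complex_Re_le_cmod[of "?V z"] by simp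
    then have "csqrt ((1 - ?V z)\<^sup>2) = 1 - ?V z" by (intro csqrt_square) simp
    then show ?thesis by (simp add: V_sq[OF z] W_def)
  qed
  have D_eq: "2 * ?D y * (1 - ?V y) = 1" if y: "norm y < 1" for y
  proof -
    have r: "ereal (norm y) < fps_conv_radius (1 - v)"
      using in_disc(2)[OF y] fps_conv_radius_diff[of 1 v] by (auto simp: min_def intro: less_le_trans)
    have r2: "ereal (norm y) < fps_conv_radius (2 * fps_deriv v)"
      using rdF(2)[OF y] fps_conv_radius_mult[of 2 "fps_deriv v"] by (auto simp: min_def intro: less_le_trans)
    have "eval_fps (2 * fps_deriv v * (1 - v)) y = 2 * ?D y * (1 - ?V y)"
      using in_disc(2)[OF y] rdF(2)[OF y] r r2 by (simp add: eval_fps_mult eval_fps_diff)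
    then show ?thesis by (simp add: dv_eq)
  qed
  have C_eq: "2 * eval_fps (fps_deriv F) y * (1 - x * ?V y) = 1" if y: "norm y < 1" for y
  proof -
    have r0: "ereal (norm y) < fps_conv_radius (fps_const x * v)"
      using in_disc(2)[OF y] fps_conv_radius_mult[of "fps_const x" v] by (auto simp: min_def intro: less_le_trans)
    have r: "ereal (norm y) < fps_conv_radius (1 - fps_const x * v)"
      using r0 fps_conv_radius_diff[of 1 "fps_const x * v"] by (auto simp: min_def intro: less_le_trans)
    have r2: "ereal (norm y) < fps_conv_radius (2 * fps_deriv F)"
      using rdF(1)[OF y] fps_conv_radius_mult[of 2 "fps_deriv F"] by (auto simp: min_def intro: less_le_trans)
    have "eval_fps (2 * fps_deriv F * (1 - fps_const x * v)) y = 2 * eval_fps (fps_deriv F) y * (1 - x * ?V y)"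
      using in_disc(2)[OF y] rdF(1)[OF y] r0 r r2 by (simp add: eval_fps_mult eval_fps_diff)
    then show ?thesis using c_eq by (simp add: cF)
  qed
  define H where "H y = eval_fps F y - 1 / x * (?V y + (1 - x) / x * Ln (1 - x * ?V y))" for y
  have "\<exists>a. \<forall>y\<in>ball 0 1. H y = a"
  proof (rule has_field_derivative_zero_constant)
    fix y :: complex assume "y \<in> ball 0 1"
    then have y: "norm y < 1" by simp
    have nz: "1 - x * ?V y \<noteq> 0" using C_eq[OF y] by auto
    have Re: "0 < Re (1 - x * ?V y)"
      using xV_less[OF y] complex_Re_le_cmod[of "x * ?V y"] by simp
    then have np: "1 - x * ?V y \<notin> \<real>\<^sub>\<le>\<^sub>0" by (auto simp: complex_nonpos_Reals_iff)
    have dV: "(?V has_field_derivative ?D y) (at y)"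
      using in_disc(2)[OF y] by (intro has_field_derivative_eval_fps) (simp add: in_eball_iff)
    have dF: "(eval_fps F has_field_derivative eval_fps (fps_deriv F) y) (at y)"
      using in_disc(1)[OF y] by (intro has_field_derivative_eval_fps) (simp add: in_eball_iff)
    have dL: "((\<lambda>y. Ln (1 - x * ?V y)) has_field_derivative inverse (1 - x * ?V y) * - (x * ?D y)) (at y)"
      by (rule DERIV_chain2[where f = Ln and g = "\<lambda>y. 1 - x * ?V y"], rule has_field_derivative_Ln[OF np])
        (auto intro!: derivative_eq_intros dV)
    have "(H has_field_derivative eval_fps (fps_deriv F) y
        - 1 / x * (?D y + (1 - x) / x * (inverse (1 - x * ?V y) * - (x * ?D y)))) (at y)"
      unfolding H_def[abs_def]
      by (intro DERIV_diff dF DERIV_cmult DERIV_add dV dL)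
    moreover have "eval_fps (fps_deriv F) y
        - 1 / x * (?D y + (1 - x) / x * (inverse (1 - x * ?V y) * - (x * ?D y))) = 0"
    proof -
      have "1 / x * (?D y + (1 - x) / x * (inverse (1 - x * ?V y) * - (x * ?D y)))
          = ?D y * (1 - ?V y) / (1 - x * ?V y)"
        using nz x by (simp add: field_simps)
      also have "?D y * (1 - ?V y) = 1 / 2"
        by (rule eq_divide_imp) (use D_eq[OF y] in \<open>simp_all add: mult.commute mult.left_commute\<close>)
      also have "1 / 2 / (1 - x * ?V y) = 1 / (2 * (1 - x * ?V y))" by simp
      also have "\<dots> = eval_fps (fps_deriv F) y"
        using C_eq[OF y] nz by (simp add: field_simps)
      finally show ?thesis by simp
    qed
    ultimately show "(H has_field_derivative 0) (at y within ball 0 1)"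
      by (metis has_field_derivative_at_within)
  qed simp
  then obtain a where a: "\<And>y. norm y < 1 \<Longrightarrow> H y = a" by auto
  have "H 0 = 0" by (simp add: H_def eval_fps_at_0 v0 F_def)
  then have "H z = 0" using a[of 0] a[OF z] by simp
  then have "eval_fps F z = 1 / x * (W + (1 - x) / x * Ln (1 - x * W))"
    by (simp add: H_def V_csqrt)
  moreover have "eval_fps F z = I"
  proof -
    have "(\<lambda>k. fps_nth F k * z ^ k) sums eval_fps F z"
      using in_disc(1)[OF z] by (rule sums_eval_fps)
    then have "(\<lambda>k. fps_nth F (Suc k) * z ^ Suc k) sums (eval_fps F z - fps_nth F 0 * z ^ 0)"
      by (subst sums_Suc_iff) simp
    then have "(\<lambda>k. fps_nth F (Suc k) * z ^ Suc k) sums eval_fps F z" by (simp add: F_def)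
    moreover have "fps_nth F (Suc k) * z ^ Suc k
        = z ^ Suc k * (\<Sum>m\<le>k. x ^ m * of_real (fps_nth (w ^ m) k)) / of_real (\<mu> * real (Suc k))" for k
      by (simp add: F_def c_def mu)
    ultimately show ?thesis using I sums_unique2 by auto
  qed
  ultimately show ?thesis by simp
qed

section \<open>The joint law of size and number of jumps\<close>

lemma prob_space_stationary:
  assumes "mean_explosion_time W < \<infinity>"
  shows "prob_space (stationary_space W)"
  unfolding stationary_space_def
  using prob_space_size_biased[OF assms] prob_space_growth_space
  by (intro prob_space_pair prob_space_PiM prob_space_uniform_measure) auto

lemma size_fps_nth_0: "fps_nth (size_fps W) 0 = 0"
  by (simp add: size_fps_def pmf_eq_0_set_pmf image_iff num_verts_pos[THEN less_imp_neq])

text \<open>The expectation of a function of size and jump count, summed first over the jump count.  At size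
  \<open>k + 1\<close> at most \<open>k\<close> jumps have occurred, so the inner sums are finite.\<close>

lemma size_and_jumps_sums:
  fixes f :: "nat \<Rightarrow> nat \<Rightarrow> 'b::{banach, second_countable_topology}"
  assumes mean: "mean_explosion_time W < \<infinity>"
    and expl: "AE \<eta> in growth_space W. explosion_time \<eta> < \<infinity>"
    and bound: "\<And>k m. norm (f k m) \<le> B"
  defines "\<mu> \<equiv> enn2real (mean_explosion_time W)"
  shows "(\<lambda>k. \<Sum>m\<le>k. (fps_nth (size_fps W ^ m) k / (\<mu> * real (Suc k))) *\<^sub>R f (Suc k) m)
    sums (\<integral>\<omega>. f (num_verts (cluster_process \<omega> 0)) (num_jumps \<omega> 0) \<partial>stationary_space W)"
proof -
  let ?S = "stationary_space W" and ?N = "count_space UNIV :: nat measure"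
  define p where "p k m = fps_nth (size_fps W ^ m) k / (\<mu> * real (Suc k))" for k m
  have mu: "mean_explosion_time W = ennreal \<mu>" "0 < \<mu>"
    using mean mean_explosion_time_pos[of W] by (auto simp: \<mu>_def enn2real_positive_iff)
  have p0: "0 \<le> p k m" for k m using mu by (simp add: p_def size_fps_power_nonneg)
  interpret S: prob_space ?S by (rule prob_space_stationary[OF mean])
  \<comment> \<open>The size is at least 1; it is shifted to start at 0 so that all pairs of naturals are possible.\<close>
  define J where "J \<omega> = (num_verts (cluster_process \<omega> 0) - 1, num_jumps \<omega> 0)" for \<omega>
  have J [measurable]: "J \<in> ?S \<rightarrow>\<^sub>M count_space UNIV"
  proof -
    have [measurable]: "(\<lambda>\<omega>. num_verts (cluster_process \<omega> 0) - 1) \<in> ?S \<rightarrow>\<^sub>M count_space UNIV"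
      by (rule measurable_compose[OF measurable_cluster_process]) simp
    have "J \<in> ?S \<rightarrow>\<^sub>M ?N \<Otimes>\<^sub>M ?N" unfolding J_def[abs_def] by measurable
    then show ?thesis by (simp add: pair_measure_countable)
  qed
  define P where "P = density (count_space UNIV) (\<lambda>q. ennreal (p (fst q) (snd q)))"
  have P: "distr ?S (count_space UNIV) J = P"
  proof (rule measure_eqI_countable[where A = UNIV])
    fix q :: "nat \<times> nat"
    obtain k m where q: "q = (k, m)" by force
    have "emeasure (distr ?S (count_space UNIV) J) {q} = emeasure ?S (J -` {q} \<inter> space ?S)"
      by (simp add: emeasure_distr)
    also have "J -` {q} \<inter> space ?S = {\<omega> \<in> space ?S.
        num_verts (cluster_process \<omega> 0) = Suc k \<and> num_jumps \<omega> 0 = m}"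
      using num_verts_pos by (auto simp: J_def q)
    also have "emeasure ?S \<dots> = ennreal (p k m)"
      unfolding emeasure_size_and_jumps[OF mean expl] using mu
      by (simp add: divide_ennreal size_fps_power_nonneg p_def mult.commute del: of_nat_Suc)
    also have "\<dots> = emeasure P {q}"
      unfolding P_def q point_measure_def[symmetric]
      by (subst emeasure_point_measure_finite2) auto
    finally show "emeasure (distr ?S (count_space UNIV) J) {q} = emeasure P {q}" .
  qed (auto simp: P_def)
  define g where "g q = f (Suc (fst q)) (snd q)" for q
  have f_eq: "f (num_verts (cluster_process \<omega> 0)) (num_jumps \<omega> 0) = g (J \<omega>)" for \<omega>
    using num_verts_pos[of "cluster_process \<omega> 0"] by (simp add: g_def J_def)
  have "integrable ?S (\<lambda>\<omega>. g (J \<omega>))"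
    by (rule S.integrable_const_bound[where B = B]) (auto simp: g_def bound)
  then have "integrable P g"
    unfolding P[symmetric] by (subst integrable_distr_eq) auto
  then have int: "integrable (count_space UNIV) (\<lambda>q. p (fst q) (snd q) *\<^sub>R g q)"
    unfolding P_def by (subst (asm) integrable_density) (auto simp: p0)
  interpret NN: pair_sigma_finite ?N ?N
    by (intro pair_sigma_finite.intro sigma_finite_measure_count_space)
  have NN: "count_space (UNIV :: (nat \<times> nat) set) = ?N \<Otimes>\<^sub>M ?N"
    by (simp add: pair_measure_countable)
  note int' = int[unfolded NN]
  have inner: "(\<integral>m. p k m *\<^sub>R g (k, m) \<partial>?N) = (\<Sum>m\<le>k. p k m *\<^sub>R f (Suc k) m)" for k
  proof -
    have "p k m = 0" if "k < m" for m
      using startsby_zero_power_prefix[OF size_fps_nth_0[of W], of m] that by (simp add: p_def)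
    then have sub: "{m. p k m *\<^sub>R g (k, m) \<noteq> 0} \<subseteq> {..k}"
      by (auto simp: not_le[symmetric])
    then have "(\<integral>m. p k m *\<^sub>R g (k, m) \<partial>?N) = (\<Sum>m | p k m *\<^sub>R g (k, m) \<noteq> 0. p k m *\<^sub>R g (k, m))"
      by (subst lebesgue_integral_count_space_finite_support) (auto intro: finite_subset)
    also have "\<dots> = (\<Sum>m\<le>k. p k m *\<^sub>R g (k, m))"
      by (rule sum.mono_neutral_left) (use sub in auto)
    finally show ?thesis by (simp add: g_def)
  qed
  have "(\<lambda>k. \<integral>m. p k m *\<^sub>R g (k, m) \<partial>?N) sums (\<integral>k. \<integral>m. p k m *\<^sub>R g (k, m) \<partial>?N \<partial>?N)"
    using NN.integrable_fst'[OF int'] by (intro sums_integral_count_space_nat) simp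
  also have "(\<integral>k. \<integral>m. p k m *\<^sub>R g (k, m) \<partial>?N \<partial>?N) = (\<integral>q. p (fst q) (snd q) *\<^sub>R g q \<partial>count_space UNIV)"
    using NN.integral_fst'[OF int'] by (simp add: NN)
  also have "\<dots> = (\<integral>q. g q \<partial>P)"
    unfolding P_def by (subst integral_density) (auto simp: p0)
  also have "\<dots> = (\<integral>\<omega>. g (J \<omega>) \<partial>?S)"
    unfolding P[symmetric] by (subst integral_distr) auto
  finally show ?thesis unfolding inner f_eq unfolding p_def .
qed

text \<open>Stationarity, read on sizes: the probability of size \<open>k + 1\<close> at time \<open>0\<close> is on the one hand the
  coefficient of the size law, on the other hand the sum of the joint law over all jump counts.\<close>

lemma size_balance:
  assumes "steady_state_law W"
  shows "enn2real (mean_explosion_time W) * real (Suc k) * fps_nth (size_fps W) (Suc k)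
    = (\<Sum>m\<le>k. fps_nth (size_fps W ^ m) k)"
proof -
  let ?S = "stationary_space W"
  have mean: "mean_explosion_time W < \<infinity>" and expl: "AE \<eta> in growth_space W. explosion_time \<eta> < \<infinity>"
    and law: "distr ?S (count_space UNIV) (\<lambda>\<omega>. cluster_process \<omega> 0) = measure_pmf W"
    using assms by (auto simp: steady_state_law_def)
  define \<mu> where "\<mu> = enn2real (mean_explosion_time W)"
  have mu: "0 < \<mu>"
    using mean mean_explosion_time_pos[of W] by (auto simp: \<mu>_def enn2real_positive_iff)
  let ?f = "\<lambda>j m. indicator {Suc k} j :: real"
  have "(\<lambda>j. \<Sum>m\<le>j. (fps_nth (size_fps W ^ m) j / (\<mu> * real (Suc j))) *\<^sub>R ?f (Suc j) m)
      sums (\<integral>\<omega>. ?f (num_verts (cluster_process \<omega> 0)) (num_jumps \<omega> 0) \<partial>?S)"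
    unfolding \<mu>_def by (rule size_and_jumps_sums[OF mean expl, where B = 1]) (auto simp: indicator_def)
  moreover have "(\<lambda>j. \<Sum>m\<le>j. (fps_nth (size_fps W ^ m) j / (\<mu> * real (Suc j))) *\<^sub>R ?f (Suc j) m)
      = (\<lambda>j. if j = k then \<Sum>m\<le>k. fps_nth (size_fps W ^ m) k / (\<mu> * real (Suc k)) else 0)"
    by (auto simp: indicator_def)
  ultimately have "(\<integral>\<omega>. ?f (num_verts (cluster_process \<omega> 0)) (num_jumps \<omega> 0) \<partial>?S)
      = (\<Sum>m\<le>k. fps_nth (size_fps W ^ m) k / (\<mu> * real (Suc k)))"
    using sums_single[of k "\<lambda>_. \<Sum>m\<le>k. fps_nth (size_fps W ^ m) k / (\<mu> * real (Suc k))"]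
    by (auto intro: sums_unique2)
  moreover have "(\<integral>\<omega>. ?f (num_verts (cluster_process \<omega> 0)) (num_jumps \<omega> 0) \<partial>?S)
      = fps_nth (size_fps W) (Suc k)"
  proof -
    have "(\<integral>\<omega>. ?f (num_verts (cluster_process \<omega> 0)) (num_jumps \<omega> 0) \<partial>?S)
        = (\<integral>G. indicator {Suc k} (num_verts G) \<partial>distr ?S (count_space UNIV) (\<lambda>\<omega>. cluster_process \<omega> 0))"
      by (subst integral_distr) auto
    also have "\<dots> = (\<integral>G. indicator (num_verts -` {Suc k}) G \<partial>measure_pmf W)"
      unfolding law by (rule Bochner_Integration.integral_cong) (auto simp: indicator_def)
    finally show ?thesis by (simp add: size_fps_def pmf_map)
  qed
  ultimately have "fps_nth (size_fps W) (Suc k) = (\<Sum>m\<le>k. fps_nth (size_fps W ^ m) k) / (\<mu> * real (Suc k))"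
    by (simp only: sum_divide_distrib)
  then show ?thesis using mu unfolding \<mu>_def[symmetric] by (simp del: of_nat_Suc)
qed

theorem lemma10:
  fixes W0 :: "rooted_graph pmf" and z x :: complex
  defines "W \<equiv> 1 - csqrt (1 - z)"
  assumes W0: "steady_state_law W0"
    and z: "norm z < 1"
    and x: "0 < norm x" "norm x \<le> 1"
  shows "(\<integral>\<omega>. z ^ num_verts (cluster_process \<omega> 0) * x ^ num_jumps \<omega> 0 \<partial>stationary_space W0)
           = 1 / x * (W + (1 - x) / x * Ln (1 - x * W))"
  unfolding W_def
proof (rule jump_generating_function)
  let ?I = "\<integral>\<omega>. z ^ num_verts (cluster_process \<omega> 0) * x ^ num_jumps \<omega> 0 \<partial>stationary_space W0"
  let ?w = "size_fps W0" and ?\<mu> = "enn2real (mean_explosion_time W0)"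
  have "(\<lambda>k. \<Sum>m\<le>k. (fps_nth (?w ^ m) k / (?\<mu> * real (Suc k))) *\<^sub>R (z ^ Suc k * x ^ m)) sums ?I"
  proof (rule size_and_jumps_sums[where B = 1])
    show "norm (z ^ k * x ^ m) \<le> 1" for k m
      using z x by (simp add: norm_mult norm_power mult_le_one power_le_one)
  qed (use W0 in \<open>auto simp: steady_state_law_def\<close>)
  then show "(\<lambda>k. z ^ Suc k * (\<Sum>m\<le>k. x ^ m * of_real (fps_nth (?w ^ m) k)) / of_real (?\<mu> * real (Suc k))) sums ?I"
    by (simp add: scaleR_conv_of_real sum_distrib_left sum_divide_distrib mult_ac del: of_nat_Suc power_Suc)
  show "fps_nth ?w sums 1"
    using sums_integral_count_space_nat[OF integrable_pmf[of UNIV "map_pmf num_verts W0"]]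
    by (simp add: size_fps_def integral_pmf Abs_fps_inverse)
qed (use z x size_balance[OF W0] in \<open>auto simp: size_fps_nth_0 size_fps_power_nonneg\<close>)

end
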